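(* Every $(2K_2, K_4, C_5)$-free graph is recolorable.
   Context: All graphs are finite and simple. For graphs $F_1,\dots,F_t$, a graph $G$ is $(F_1,\dots,F_t)$-free if no induced subgraph of $G$ is isomorphic to any $F_j$. $2K_2$ is the disjoint union of two copies of $K_2$ (two disjoint edges on four vertices with no other edges), $K_4$ is the complete graph on four vertices, $C_5$ is the cycle on five vertices. An $\ell$-coloring of $G$ is a map $V(G)\to\{1,\dots,\ell\}$ giving adjacent vertices distinct colors (not all colors need be used); $\chi(G)$ is the least $\ell$ for which an $\ell$-coloring exists. The reconfiguration graph $\mathcal{R}_\ell(G)$ has the $\ell$-colorings of $G$ as vertices, with two colorings adjacent whenever they differ on exactly one vertex of $G$. The graph $G$ is recolorable if $\mathcal{R}_\ell(G)$ is connected for every $\ell>\chi(G)$. *)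

theory Defs
  imports "Graph_Theory.Graph_Theory" "HOL-Library.FuncSet"
begin

text \<open>
  Finite simple graphs are rendered by the locale \<open>pair_graph\<close>: a finite vertex set with a
  symmetric, irreflexive set of arcs, an undirected edge \<open>uv\<close> being the two arcs \<open>(u, v)\<close> and
  \<open>(v, u)\<close>.  The null graph is allowed.
\<close>

definition two_K2 :: "nat pair_pre_digraph" where
  "two_K2 = \<lparr> pverts = {0, 1, 2, 3}, parcs = {(0, 1), (1, 0), (2, 3), (3, 2)} \<rparr>"

definition complete_graph :: "nat \<Rightarrow> nat pair_pre_digraph" where
  "complete_graph n = \<lparr> pverts = {..<n}, parcs = {(i, j). i < n \<and> j < n \<and> i \<noteq> j} \<rparr>"

text \<open>The cycle on \<open>n\<close> vertices; only meaningful for \<open>n \<ge> 3\<close>.\<close>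

definition cycle_graph :: "nat \<Rightarrow> nat pair_pre_digraph" where
  "cycle_graph n = \<lparr> pverts = {..<n},
     parcs = {(i, j). i < n \<and> j < n \<and> (j = (i + 1) mod n \<or> i = (j + 1) mod n)} \<rparr>"

definition induced_free :: "nat pair_pre_digraph list \<Rightarrow> 'a pair_pre_digraph \<Rightarrow> bool" where
  "induced_free Fs G \<longleftrightarrow>
     (\<forall>F \<in> set Fs. \<not> (\<exists>H. induced_subgraph H (with_proj G) \<and> digraph_iso H (with_proj F)))"

text \<open>
  Colorings are extensional functions (\<open>undefined\<close> outside the vertex set), so that two
  colorings are equal iff they agree on all vertices.
\<close>

definition colorings :: "'a pair_pre_digraph \<Rightarrow> nat \<Rightarrow> ('a \<Rightarrow> nat) set" where
  "colorings G l =
     {c \<in> pverts G \<rightarrow>\<^sub>E {1..l}. \<forall>(u, v) \<in> parcs G. c u \<noteq> c v}"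

definition chromatic_number :: "'a pair_pre_digraph \<Rightarrow> nat" where
  "chromatic_number G = (LEAST l. colorings G l \<noteq> {})"

definition reconfiguration_graph ::
    "'a pair_pre_digraph \<Rightarrow> nat \<Rightarrow> ('a \<Rightarrow> nat) pair_pre_digraph" where
  "reconfiguration_graph G l = \<lparr> pverts = colorings G l,
     parcs = {(c, d). c \<in> colorings G l \<and> d \<in> colorings G l \<and>
                      (\<exists>!v. v \<in> pverts G \<and> c v \<noteq> d v)} \<rparr>"

definition recolorable :: "'a pair_pre_digraph \<Rightarrow> bool" where
  "recolorable G \<longleftrightarrow>
     (\<forall>l > chromatic_number G.
        Digraph_Component.connected (with_proj (reconfiguration_graph G l)))"

lemma pair_graph_two_K2: "pair_graph two_K2"
  by unfold_locales (auto simp: two_K2_def symmetric_def intro!: symI)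

lemma finite_nat_arcs:
  "finite {(i, j). i < (n::nat) \<and> j < n \<and> P i j}"
  by (rule finite_subset[of _ "{..<n} \<times> {..<n}"]) auto

lemma pair_graph_complete_graph: "pair_graph (complete_graph n)"
  by unfold_locales
    (auto simp: complete_graph_def symmetric_def finite_nat_arcs intro!: symI)

lemma complete_digraph_complete_graph: "K\<^bsub>n\<^esub> (with_proj (complete_graph n))"
  unfolding complete_digraph_pair_def by (auto simp: complete_graph_def)

lemma pair_graph_cycle_graph:
  assumes "n \<ge> 3"
  shows "pair_graph (cycle_graph n)"
proof -
  have "Suc i mod n \<noteq> i" if "i < n" for i
    using assms that by (cases "Suc i = n") auto
  then show ?thesis
    by unfold_locales
      (auto simp: cycle_graph_def symmetric_def finite_nat_arcs dest: sym intro!: symI)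
qed

lemma pair_graph_reconfiguration_graph:
  assumes "finite (pverts G)"
  shows "pair_graph (reconfiguration_graph G l)"
proof -
  have "finite (colorings G l)"
    by (rule finite_subset[of _ "pverts G \<rightarrow>\<^sub>E {1..l}"])
      (auto simp: colorings_def intro: assms finite_PiE)
  moreover have "parcs (reconfiguration_graph G l) \<subseteq> colorings G l \<times> colorings G l"
    by (auto simp: reconfiguration_graph_def)
  ultimately have "finite (parcs (reconfiguration_graph G l))" "finite (colorings G l)"
    by (auto intro: finite_subset)
  then show ?thesis
    by unfold_locales
      (auto simp: reconfiguration_graph_def symmetric_def eq_commute intro!: symI)
qed

end

theory Submission
  imports Defs
begin

text \<open>
  We work in the complement, with \<open>F u v\<close> meaning that \<open>u\<close> and \<open>v\<close> are equal or non-adjacent; then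
  colour classes are cliques of \<open>F\<close>, and \<open>F\<close> has no induced \<open>C\<^sub>4\<close>, no induced \<open>C\<^sub>5\<close> and no four
  pairwise unrelated vertices.  Induct on the number of vertices.  A vertex whose neighbourhood in
  the graph is contained in that of a non-adjacent vertex can be removed, since it may copy the
  colours of the latter.  A universal vertex is handled as a singleton colour class.  If there are
  no such vertices, prolonging an induced path of \<open>F\<close> yields a hole of length 6 or 7.

  If every hole has length 6, then \<open>F\<close> is the 6-cycle.  Otherwise the vertices are arranged
  cyclically around a 7-hole \<open>h\<close>.  There is a cyclic family of cliques \<open>S i\<close>, each containing \<open>h i\<close>
  and \<open>h (i + 1)\<close>, whose removal destroys all 7-holes and hence leaves a 3-colourable graph, such
  that every colouring has a class within some \<open>S i\<close>.  Recolouring all of \<open>S i\<close> with the colour of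
  that class turns \<open>S i\<close> into a class, and the induction hypothesis applies to the other vertices.
  Two disjoint cliques of the family can be classes simultaneously, which allows passing from any
  one of them to any other.
\<close>

section \<open>Recolouring\<close>

locale reflexive_symmetric =
  fixes F :: "'a \<Rightarrow> 'a \<Rightarrow> bool"
  assumes F_refl [simp, intro]: "F x x"
    and F_sym: "F x y \<Longrightarrow> F y x"
begin

section \<open>Colourings as partitions into cliques of \<open>F\<close>, and their
  recolourings\<close>

definition proper :: "'a set \<Rightarrow> nat set \<Rightarrow> ('a \<Rightarrow> nat) \<Rightarrow> bool" where
  "proper V C f \<longleftrightarrow> f ` V \<subseteq> C \<and> (\<forall>u\<in>V. \<forall>v\<in>V. f u = f v \<longrightarrow> F u v)"

definition colorable :: "'a set \<Rightarrow> nat \<Rightarrow> bool" where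
  "colorable V n \<longleftrightarrow> (\<exists>f. proper V {..<n} f)"

text \<open>Colourings are total functions of which only the values on \<open>V\<close> count. A
  step may change nothing on \<open>V\<close>, so colourings that agree on \<open>V\<close> are
  linked as well.\<close>

definition recolor_step :: "'a set \<Rightarrow> nat set \<Rightarrow> ('a \<Rightarrow> nat) \<Rightarrow> ('a \<Rightarrow> nat) \<Rightarrow> bool" where
  "recolor_step V C f g \<longleftrightarrow>
     proper V C f \<and> proper V C g \<and> (\<exists>x. \<forall>u\<in>V. u \<noteq> x \<longrightarrow> f u = g u)"

abbreviation recolors :: "'a set \<Rightarrow> nat set \<Rightarrow> ('a \<Rightarrow> nat) \<Rightarrow> ('a \<Rightarrow> nat) \<Rightarrow> bool" where
  "recolors V C \<equiv> (recolor_step V C)\<^sup>*\<^sup>*"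

definition mixing :: "'a set \<Rightarrow> nat set \<Rightarrow> bool" where
  "mixing V C \<longleftrightarrow> (\<forall>f g. proper V C f \<longrightarrow> proper V C g \<longrightarrow> recolors V C f g)"

lemma F_commute: "F x y \<longleftrightarrow> F y x"
  using F_sym by blast

lemma properI:
  assumes "\<And>v. v \<in> V \<Longrightarrow> f v \<in> C"
    and "\<And>u v. u \<in> V \<Longrightarrow> v \<in> V \<Longrightarrow> u \<noteq> v \<Longrightarrow> f u = f v \<Longrightarrow> F u v"
  shows "proper V C f"
  using assms unfolding proper_def by (metis F_refl image_subsetI)

lemma proper_in: "proper V C f \<Longrightarrow> v \<in> V \<Longrightarrow> f v \<in> C"
  by (auto simp: proper_def)

lemma proper_F: "proper V C f \<Longrightarrow> u \<in> V \<Longrightarrow> v \<in> V \<Longrightarrow> f u = f v \<Longrightarrow> F u v"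
  by (auto simp: proper_def)

lemma proper_mono: "proper V C f \<Longrightarrow> W \<subseteq> V \<Longrightarrow> C \<subseteq> D \<Longrightarrow> proper W D f"
  unfolding proper_def by blast

lemma proper_cong: "(\<And>v. v \<in> V \<Longrightarrow> f v = g v) \<Longrightarrow> proper V C f \<longleftrightarrow> proper V C g"
  by (auto simp: proper_def)

lemma proper_transfer:
  assumes "proper V C f" "finite C" "finite D" "card C \<le> card D"
  shows "\<exists>g. proper V D g"
proof -
  obtain h where h: "inj_on h C" "h ` C \<subseteq> D"
    using assms card_le_inj by metis
  have "proper V D (h \<circ> f)"
  proof (rule properI)
    show "(h \<circ> f) v \<in> D" if "v \<in> V" for v
      using h proper_in[OF assms(1)] that by auto
    show "F u v" if "u \<in> V" "v \<in> V" "(h \<circ> f) u = (h \<circ> f) v" for u v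
      using that inj_onD[OF h(1), of "f u" "f v"] proper_in[OF assms(1)] proper_F[OF assms(1)]
      by auto
  qed
  then show ?thesis by blast
qed

lemma colorableI: "proper V D f \<Longrightarrow> finite D \<Longrightarrow> card D \<le> n \<Longrightarrow> colorable V n"
  unfolding colorable_def using proper_transfer[of V D f "{..<n}"] by auto

lemma colorableD: "colorable V n \<Longrightarrow> finite D \<Longrightarrow> n \<le> card D \<Longrightarrow> \<exists>g. proper V D g"
  unfolding colorable_def using proper_transfer[of V "{..<n}" _ D] by auto

lemma colorable_mono: "colorable V n \<Longrightarrow> W \<subseteq> V \<Longrightarrow> n \<le> m \<Longrightarrow> colorable W m"
  unfolding colorable_def using proper_mono[of V "{..<n}" _ W "{..<m}"] by auto

lemma recolor_step_sym: "recolor_step V C f g \<Longrightarrow> recolor_step V C g f"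
  unfolding recolor_step_def by metis

lemma recolors_sym: "recolors V C f g \<Longrightarrow> recolors V C g f"
  by (induction rule: rtranclp_induct)
    (auto intro: converse_rtranclp_into_rtranclp recolor_step_sym)

lemma recolors_cong:
  assumes "proper V C f" "\<And>v. v \<in> V \<Longrightarrow> f v = g v"
  shows "recolors V C f g"
proof -
  have "proper V C g"
    using assms proper_cong[of V f g C] by blast
  then show ?thesis
    using assms by (auto simp: recolor_step_def)
qed

lemma recolors_proper: "recolors V C f g \<Longrightarrow> proper V C f \<Longrightarrow> proper V C g"
  by (induction rule: rtranclp_induct) (auto simp: recolor_step_def)

text \<open>In the complement of \<open>F\<close> every neighbour of \<open>u\<close> is a neighbour of \<open>v\<close>.\<close>

definition dominates :: "'a set \<Rightarrow> 'a \<Rightarrow> 'a \<Rightarrow> bool" where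
  "dominates V u v \<longleftrightarrow> u \<in> V \<and> v \<in> V \<and> u \<noteq> v \<and> (\<forall>w\<in>V. F v w \<longrightarrow> F u w)"

text \<open>The class of \<open>v\<close> consists of vertices related to \<open>v\<close>, hence to
  \<open>u\<close>, so \<open>u\<close> may join it.\<close>

lemma proper_copy:
  assumes d: "dominates V u v" and f: "proper (V - {u}) C f"
  shows "proper V C (f(u := f v))"
proof (rule properI)
  have v: "v \<in> V - {u}" using d by (auto simp: dominates_def)
  show "(f(u := f v)) x \<in> C" if "x \<in> V" for x
    using proper_in[OF f] v that by auto
  fix x y assume xy: "x \<in> V" "y \<in> V" "x \<noteq> y" "(f(u := f v)) x = (f(u := f v)) y"
  have *: "F u w" if "w \<in> V - {u}" "f w = f v" for w
    using proper_F[OF f v, of w] that d by (auto simp: dominates_def)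
  show "F x y"
    using xy proper_F[OF f, of x y] *[of x] *[of y] by (auto split: if_splits intro: F_sym)
qed

lemma colorable_dominates:
  assumes "dominates V u v" "colorable (V - {u}) n"
  shows "colorable V n"
  using assms proper_copy unfolding colorable_def by blast

text \<open>A recolouring of \<open>V - {u}\<close> is lifted by letting \<open>u\<close> copy
  \<open>v\<close>. A step that changes \<open>v\<close> becomes two steps, first \<open>v\<close>
  and then \<open>u\<close>; in between, \<open>u\<close> stays with the former class of
  \<open>v\<close>, whose members are all related to \<open>u\<close>.\<close>

lemma mixing_dominates:
  assumes d: "dominates V u v" and m: "mixing (V - {u}) C"
  shows "mixing V C"
proof -
  have v: "v \<in> V" "v \<noteq> u" "u \<in> V" and dom: "\<And>w. w \<in> V \<Longrightarrow> F v w \<Longrightarrow> F u w"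
    using d by (auto simp: dominates_def)
  have step_lift: "recolors V C (a(u := a v)) (b(u := b v))" if ab: "recolor_step (V - {u}) C a b" for a b
  proof -
    obtain x where pa: "proper (V - {u}) C a" and pb: "proper (V - {u}) C b"
      and x: "\<And>w. w \<in> V - {u} \<Longrightarrow> w \<noteq> x \<Longrightarrow> a w = b w"
      using ab unfolding recolor_step_def by blast
    have A: "proper V C (a(u := a v))" and B: "proper V C (b(u := b v))"
      using proper_copy[OF d] pa pb by auto
    show ?thesis
    proof (cases "a v = b v")
      case True
      then have "recolor_step V C (a(u := a v)) (b(u := b v))"
        using A B x unfolding recolor_step_def by (intro conjI exI[of _ x]) auto
      then show ?thesis by blast
    next
      case False
      then have xv: "x = v" using x[of v] v by auto
      have F_u: "F u w" if w: "w \<in> V - {u}" "b w = a v" for w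
      proof (cases "w = v")
        case True then show ?thesis using dom v by blast
      next
        case False
        then have "a w = a v" using x[of w] w xv by auto
        then show ?thesis using proper_F[OF pa, of v w] w v dom by auto
      qed
      have M: "proper V C (b(u := a v))"
      proof (rule properI)
        show "(b(u := a v)) y \<in> C" if "y \<in> V" for y
          using proper_in[OF pa, of v] proper_in[OF pb, of y] v that by auto
        show "F y z" if "y \<in> V" "z \<in> V" "y \<noteq> z" "(b(u := a v)) y = (b(u := a v)) z" for y z
          using that proper_F[OF pb, of y z] F_u[of y] F_u[of z]
          by (auto split: if_splits intro: F_sym)
      qed
      have "recolor_step V C (a(u := a v)) (b(u := a v))"
        using A M x xv unfolding recolor_step_def by (intro conjI exI[of _ v]) auto
      moreover have "recolor_step V C (b(u := a v)) (b(u := b v))"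
        using B M unfolding recolor_step_def by (intro conjI exI[of _ u]) auto
      ultimately show ?thesis by (meson r_into_rtranclp rtranclp_trans)
    qed
  qed
  have lift: "recolors V C (a(u := a v)) (b(u := b v))" if "recolors (V - {u}) C a b" for a b
    using that
  proof (induction rule: rtranclp_induct)
    case base
    then show ?case by simp
  next
    case (step y z)
    then show ?case using step_lift[of y z] by (meson rtranclp_trans)
  qed
  have start: "recolors V C f (f(u := f v))" if f: "proper V C f" for f
  proof -
    have "proper V C (f(u := f v))"
      by (rule proper_copy[OF d proper_mono[OF f]]) auto
    then have "recolor_step V C f (f(u := f v))"
      using f unfolding recolor_step_def by (intro conjI exI[of _ u]) auto
    then show ?thesis by blast
  qed
  show ?thesis unfolding mixing_def
  proof (intro allI impI)
    fix f g assume f: "proper V C f" and g: "proper V C g"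
    have "recolors (V - {u}) C f g"
      using m proper_mono[OF f, of "V - {u}" C] proper_mono[OF g, of "V - {u}" C]
      by (auto simp: mixing_def)
    then show "recolors V C f g"
      using start[OF f] recolors_sym[OF start[OF g]] lift by (meson rtranclp_trans)
  qed
qed

section \<open>Turning cliques into colour classes\<close>

definition clique :: "'a set \<Rightarrow> bool" where
  "clique S \<longleftrightarrow> (\<forall>u\<in>S. \<forall>v\<in>S. F u v)"

text \<open>The vertices of \<open>S\<close> are moved to colour \<open>c\<close> one at a time.
  Class \<open>c\<close> remains inside the clique \<open>S\<close> throughout, and the other
  classes only shrink.\<close>

lemma recolors_fill_class:
  assumes f: "proper V C f" and S: "finite S" "clique S" "S \<subseteq> V" and c: "c \<in> C"
    and cls: "\<And>v. v \<in> V \<Longrightarrow> f v = c \<Longrightarrow> v \<in> S"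
  shows "recolors V C f (\<lambda>v. if v \<in> S then c else f v)"
proof -
  have proper: "proper V C (\<lambda>v. if v \<in> T then c else f v)" if "T \<subseteq> S" for T
  proof (rule properI)
    show "(if v \<in> T then c else f v) \<in> C" if "v \<in> V" for v
      using c proper_in[OF f] that by auto
    show "F u v" if "u \<in> V" "v \<in> V" "u \<noteq> v"
      "(if u \<in> T then c else f u) = (if v \<in> T then c else f v)" for u v
      using that S(2) cls[of u] cls[of v] \<open>T \<subseteq> S\<close> proper_F[OF f, of u v]
      unfolding clique_def by (auto split: if_splits)
  qed
  have "recolors V C f (\<lambda>v. if v \<in> T then c else f v)" if "finite T" "T \<subseteq> S" for T
    using that
  proof (induction T rule: finite_induct)
    case empty
    then show ?case by simp
  next
    case (insert x T)
    then have "recolor_step V C (\<lambda>v. if v \<in> T then c else f v)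
        (\<lambda>v. if v \<in> insert x T then c else f v)"
      unfolding recolor_step_def
      using proper[of T] proper[of "insert x T"] by (intro conjI exI[of _ x]) auto
    then show ?case using insert by (meson insert_subset rtranclp.rtrancl_into_rtrancl)
  qed
  then show ?thesis using S by blast
qed

definition class_at :: "'a set \<Rightarrow> nat set \<Rightarrow> ('a \<Rightarrow> nat) \<Rightarrow> 'a set \<Rightarrow> nat \<Rightarrow> bool" where
  "class_at V C f S c \<longleftrightarrow> proper V C f \<and> c \<in> C \<and> (\<forall>v\<in>V. f v = c \<longleftrightarrow> v \<in> S)"

lemma class_at_fill:
  assumes f: "proper V C f" and S: "finite S" "clique S" "S \<subseteq> V" and c: "c \<in> C"
    and cls: "\<And>v. v \<in> V \<Longrightarrow> f v = c \<Longrightarrow> v \<in> S"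
  shows "\<exists>g. class_at V C g S c \<and> recolors V C f g"
proof -
  let ?g = "\<lambda>v. if v \<in> S then c else f v"
  have r: "recolors V C f ?g" by (rule recolors_fill_class) (use assms in auto)
  then have "class_at V C ?g S c"
    using recolors_proper[OF r f] c cls by (auto simp: class_at_def)
  then show ?thesis using r by blast
qed

text \<open>With \<open>S\<close> frozen at colour \<open>c\<close>, a recolouring sequence of
  \<open>V - S\<close> that avoids \<open>c\<close> lifts step by step.\<close>

lemma recolors_same_class:
  assumes m: "mixing (V - S) (C - {c})" and S: "clique S" "S \<subseteq> V"
    and f: "class_at V C f S c" and g: "class_at V C g S c"
  shows "recolors V C f g"
proof -
  define e where "e a = (\<lambda>v. if v \<in> S then c else a v)" for a :: "'a \<Rightarrow> nat"
  have proper: "proper V C (e a)" if a: "proper (V - S) (C - {c}) a" for a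
  proof (rule properI)
    show "e a v \<in> C" if "v \<in> V" for v
      using f proper_in[OF a, of v] that by (auto simp: e_def class_at_def)
    show "F u v" if "u \<in> V" "v \<in> V" "e a u = e a v" for u v
      using that S proper_F[OF a, of u v] proper_in[OF a, of u] proper_in[OF a, of v]
      unfolding clique_def e_def by (auto split: if_splits)
  qed
  have lift_step: "recolor_step V C (e a) (e b)" if ab: "recolor_step (V - S) (C - {c}) a b" for a b
  proof -
    obtain x where "\<forall>u\<in>V - S. u \<noteq> x \<longrightarrow> a u = b u"
      using ab unfolding recolor_step_def by blast
    then show ?thesis
      using ab proper unfolding recolor_step_def by (intro conjI exI[of _ x]) (auto simp: e_def)
  qed
  have lift: "recolors V C (e a) (e b)" if ab: "recolors (V - S) (C - {c}) a b" for a b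
    using ab by (induction rule: rtranclp_induct)
      (auto intro: rtranclp.rtrancl_into_rtrancl lift_step)
  have restr: "proper (V - S) (C - {c}) h" and eq: "recolors V C h (e h)" if "class_at V C h S c" for h
  proof -
    show "proper (V - S) (C - {c}) h"
      using that unfolding class_at_def proper_def by blast
    show "recolors V C h (e h)"
      by (rule recolors_cong) (use that S in \<open>auto simp: class_at_def e_def\<close>)
  qed
  have "recolors (V - S) (C - {c}) f g"
    using m restr f g unfolding mixing_def by blast
  then show ?thesis
    using eq[OF f] recolors_sym[OF eq[OF g]] lift by (meson rtranclp_trans)
qed

text \<open>
  A colouring having \<open>S\<close> as a class is a colouring of \<open>V - S\<close> with one colour less.  The spare
  colours allow the class \<open>S\<close> to change its colour, and two disjoint members of the family to be
  classes simultaneously.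
\<close>

lemma mixing_family:
  assumes fin: "finite V" "finite C"
    and two: "card C \<ge> 2"
    and clq: "\<And>S. S \<in> \<S> \<Longrightarrow> clique S \<and> S \<subseteq> V"
    and col: "\<And>S. S \<in> \<S> \<Longrightarrow> colorable (V - S) (card C - 2)"
    and mix: "\<And>S c. S \<in> \<S> \<Longrightarrow> c \<in> C \<Longrightarrow> mixing (V - S) (C - {c})"
    and cls: "\<And>f. proper V C f \<Longrightarrow> \<exists>c\<in>C. \<exists>S\<in>\<S>. \<forall>v\<in>V. f v = c \<longrightarrow> v \<in> S"
    and linked: "\<And>S T. S \<in> \<S> \<Longrightarrow> T \<in> \<S> \<Longrightarrow>
        (\<lambda>S T. S \<in> \<S> \<and> T \<in> \<S> \<and> S \<inter> T = {})\<^sup>*\<^sup>* S T"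
  shows "mixing V C"
proof -
  have two_classes: "\<exists>h. class_at V C h S c \<and> (\<forall>v\<in>V. h v = d \<longleftrightarrow> v \<in> T)"
    if "S \<in> \<S>" and T: "clique T" "T \<subseteq> V" "S \<inter> T = {}" and cd: "c \<in> C" "d \<in> C" "c \<noteq> d" for S T c d
  proof -
    have S: "clique S" "S \<subseteq> V" using clq that by auto
    \<comment> \<open>Colouring \<open>V - S\<close> with two colours fewer leaves both
      \<open>c\<close> and \<open>d\<close> free, one for \<open>S\<close> and one for
      \<open>T\<close>.\<close>
    have "card (C - {c, d}) = card C - 2"
      using cd fin by (simp add: card_Diff_subset)
    then obtain a where a: "proper (V - S) (C - {c, d}) a"
      using colorableD[OF col[OF \<open>S \<in> \<S>\<close>], of "C - {c, d}"] fin by auto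
    define h where "h v = (if v \<in> S then c else if v \<in> T then d else a v)" for v
    have ad: "a v \<in> C - {c, d}" if "v \<in> V" "v \<notin> S" for v
      using proper_in[OF a, of v] that by auto
    have "proper V C h"
    proof (rule properI)
      show "h v \<in> C" if "v \<in> V" for v
        using ad[of v] cd that by (auto simp: h_def)
      show "F u v" if "u \<in> V" "v \<in> V" "h u = h v" for u v
        using that S T cd ad[of u] ad[of v] proper_F[OF a, of u v]
        unfolding clique_def h_def by (auto split: if_splits)
    qed
    moreover have "h v = c \<longleftrightarrow> v \<in> S" "h v = d \<longleftrightarrow> v \<in> T" if "v \<in> V" for v
      using ad[of v] cd T that by (auto simp: h_def)
    ultimately show ?thesis using cd by (auto simp: class_at_def)
  qed
  have same: "recolors V C f g"
    if "S \<in> \<S>" and f: "class_at V C f S c" and g: "class_at V C g S c" for f g S c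
    using recolors_same_class[OF mix _ _ f g] clq that by (auto simp: class_at_def)
  have swap: "recolors V C f g"
    if S: "S \<in> \<S>" and f: "class_at V C f S c" and g: "class_at V C g S d" for f g S c d
  proof (cases "c = d")
    case True then show ?thesis using same that by blast
  next
    case False
    have cd: "c \<in> C" "d \<in> C" using f g by (auto simp: class_at_def)
    obtain h where h: "class_at V C h S c" "\<forall>v\<in>V. h v = d \<longleftrightarrow> v \<in> {}"
      using two_classes[OF S _ _ _ cd False, of "{}"] by (auto simp: clique_def)
    obtain k where "class_at V C k S d" "recolors V C h k"
      using class_at_fill[of V C h S d] h clq[OF S] cd fin
      by (auto simp: class_at_def dest: finite_subset)
    then show ?thesis
      using same[OF S f h(1)] same[OF S _ g, of k] by (meson rtranclp_trans)
  qed
  have meet: "recolors V C f g"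
    if "(\<lambda>S T. S \<in> \<S> \<and> T \<in> \<S> \<and> S \<inter> T = {})\<^sup>*\<^sup>* S T" "S \<in> \<S>"
      "class_at V C f S c" "class_at V C g T d" for f g S T c d
    using that
  proof (induction arbitrary: g d rule: rtranclp_induct)
    case base
    then show ?case using swap by blast
  next
    case (step T U)
    obtain a b where ab: "a \<in> C" "b \<in> C" "a \<noteq> b"
      using two fin by (metis card_le_Suc0_iff_eq not_less_eq_eq numeral_2_eq_2)
    have TU: "T \<in> \<S>" "U \<in> \<S>" "T \<inter> U = {}" using step by auto
    \<comment> \<open>\<open>h\<close> has both \<open>T\<close> and \<open>U\<close> as classes:
      the induction hypothesis reaches it through \<open>T\<close>, and \<open>swap\<close> leaves
      it through \<open>U\<close>.\<close>
    obtain h where h: "class_at V C h T a" "\<forall>v\<in>V. h v = b \<longleftrightarrow> v \<in> U"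
      using two_classes[OF TU(1) _ _ TU(3) ab] clq[OF TU(2)] by auto
    have "class_at V C h U b" using h ab by (auto simp: class_at_def)
    then have "recolors V C h g" using swap TU step.prems by blast
    moreover have "recolors V C f h" using step.IH step.prems h by blast
    ultimately show ?case by (meson rtranclp_trans)
  qed
  have reach: "\<exists>S\<in>\<S>. \<exists>c h. class_at V C h S c \<and> recolors V C f h" if f: "proper V C f" for f
  proof -
    obtain c S where "c \<in> C" "S \<in> \<S>" "\<forall>v\<in>V. f v = c \<longrightarrow> v \<in> S" using cls[OF f] by blast
    then show ?thesis
      using class_at_fill[OF f, of S c] clq fin by (meson finite_subset)
  qed
  show ?thesis unfolding mixing_def
  proof (intro allI impI)
    fix f g assume fg: "proper V C f" "proper V C g"
    obtain S c h where h: "S \<in> \<S>" "class_at V C h S c" "recolors V C f h"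
      using reach[OF fg(1)] by blast
    obtain T d k where k: "T \<in> \<S>" "class_at V C k T d" "recolors V C g k"
      using reach[OF fg(2)] by blast
    have "recolors V C h k" using meet[OF linked] h k by blast
    then show "recolors V C f g" using h(3) recolors_sym[OF k(3)] by (meson rtranclp_trans)
  qed
qed

end

section \<open>Holes in the complement\<close>

context reflexive_symmetric
begin

text \<open>
  The complement of \<open>F\<close> on \<open>V\<close> is \<open>2K\<^sub>2\<close>-, \<open>C\<^sub>5\<close>- and \<open>K\<^sub>4\<close>-free; as \<open>F\<close> is reflexive, the vertices need
  not be assumed distinct.
\<close>

definition thin :: "'a set \<Rightarrow> bool" where
  "thin V \<longleftrightarrow>
     (\<forall>a b c d. {a, b, c, d} \<subseteq> V \<longrightarrow> F a b \<and> F b c \<and> F c d \<and> F d a \<longrightarrow> F a c \<or> F b d) \<and>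
     (\<forall>a b c d e. {a, b, c, d, e} \<subseteq> V \<longrightarrow> F a b \<and> F b c \<and> F c d \<and> F d e \<and> F e a \<longrightarrow>
        F a c \<or> F a d \<or> F b d \<or> F b e \<or> F c e) \<and>
     (\<forall>a b c d. {a, b, c, d} \<subseteq> V \<longrightarrow> F a b \<or> F a c \<or> F a d \<or> F b c \<or> F b d \<or> F c d)"

lemma thin_C4:
  "thin V \<Longrightarrow> a \<in> V \<Longrightarrow> b \<in> V \<Longrightarrow> c \<in> V \<Longrightarrow> d \<in> V \<Longrightarrow>
    F a b \<Longrightarrow> F b c \<Longrightarrow> F c d \<Longrightarrow> F d a \<Longrightarrow> F a c \<or> F b d"
  unfolding thin_def
  by (drule conjunct1) (elim allE[of _ a] allE[of _ b] allE[of _ c] allE[of _ d], simp)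

lemma thin_C5:
  "thin V \<Longrightarrow> a \<in> V \<Longrightarrow> b \<in> V \<Longrightarrow> c \<in> V \<Longrightarrow> d \<in> V \<Longrightarrow> e \<in> V \<Longrightarrow>
    F a b \<Longrightarrow> F b c \<Longrightarrow> F c d \<Longrightarrow> F d e \<Longrightarrow> F e a \<Longrightarrow>
    F a c \<or> F a d \<or> F b d \<or> F b e \<or> F c e"
  unfolding thin_def
  by (drule conjunct2, drule conjunct1)
    (elim allE[of _ a] allE[of _ b] allE[of _ c] allE[of _ d] allE[of _ e], simp)

lemma thin_K4:
  "thin V \<Longrightarrow> a \<in> V \<Longrightarrow> b \<in> V \<Longrightarrow> c \<in> V \<Longrightarrow> d \<in> V \<Longrightarrow>
    F a b \<or> F a c \<or> F a d \<or> F b c \<or> F b d \<or> F c d"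
  unfolding thin_def
  by (drule conjunct2, drule conjunct2)
    (elim allE[of _ a] allE[of _ b] allE[of _ c] allE[of _ d], simp)

lemma thin_mono: "thin V \<Longrightarrow> W \<subseteq> V \<Longrightarrow> thin W"
  unfolding thin_def by (elim conjE, intro conjI; meson order_trans)

text \<open>An induced cycle of \<open>F\<close>, indexed periodically by all integers so that
  \<open>h (i + 1)\<close> needs no reduction. For lengths 6 and 7 the last condition already makes
  vertices with incongruent indices distinct.\<close>

definition hole :: "'a set \<Rightarrow> int \<Rightarrow> (int \<Rightarrow> 'a) \<Rightarrow> bool" where
  "hole V n h \<longleftrightarrow> (\<forall>i. h i \<in> V) \<and> (\<forall>i. h (i mod n) = h i) \<and>
     (\<forall>i j. F (h i) (h j) \<longleftrightarrow> (j - i) mod n \<in> {0, 1, n - 1})"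

lemma hole_mono: "hole V n h \<Longrightarrow> V \<subseteq> W \<Longrightarrow> hole W n h"
  by (auto simp: hole_def)

lemma hole_listI:
  assumes "length xs = n" "n > 0" "set xs \<subseteq> V"
    and "\<And>a b. a < n \<Longrightarrow> b < n \<Longrightarrow>
      F (xs ! a) (xs ! b) \<longleftrightarrow> (int b - int a) mod int n \<in> {0, 1, int n - 1}"
  shows "hole V (int n) (\<lambda>i. xs ! nat (i mod int n))"
  unfolding hole_def
proof (intro conjI allI)
  have lt: "nat (i mod int n) < n" for i
    using assms(2) by (simp add: nat_less_iff)
  show "xs ! nat (i mod int n) \<in> V" for i
    using lt assms(1,3) nth_mem by blast
  show "xs ! nat (i mod int n mod int n) = xs ! nat (i mod int n)" for i by simp
  show "F (xs ! nat (i mod int n)) (xs ! nat (j mod int n)) \<longleftrightarrow>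
      (j - i) mod int n \<in> {0, 1, int n - 1}" for i j
    using assms(4)[OF lt lt, of i j] assms(2) by (simp add: mod_diff_eq)
qed

lemma hole6I:
  assumes "{a, b, c, d, e, f} \<subseteq> V"
    and "F a b" "F b c" "F c d" "F d e" "F e f" "F f a"
    and "\<not> F a c" "\<not> F a d" "\<not> F a e" "\<not> F b d" "\<not> F b e" "\<not> F b f" "\<not> F c e" "\<not> F c f" "\<not> F d f"
  shows "\<exists>h. hole V 6 h"
proof -
  have *: "F b a" "F c b" "F d c" "F e d" "F f e" "F a f"
    "\<not> F c a" "\<not> F d a" "\<not> F e a" "\<not> F d b" "\<not> F e b" "\<not> F f b" "\<not> F e c" "\<not> F f c" "\<not> F f d"
    using assms by (auto dest: F_sym)
  have "hole V (int 6) (\<lambda>i. [a, b, c, d, e, f] ! nat (i mod int 6))"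
  proof (rule hole_listI)
    fix x y :: nat
    assume "x < 6" "y < 6"
    then have "x \<in> {0, 1, 2, 3, 4, 5}" "y \<in> {0, 1, 2, 3, 4, 5}" by auto
    then show "F ([a, b, c, d, e, f] ! x) ([a, b, c, d, e, f] ! y) \<longleftrightarrow>
        (int y - int x) mod int 6 \<in> {0, 1, int 6 - 1}"
      by (elim insertE emptyE; simp add: assms *)
  qed (use assms(1) in auto)
  then show ?thesis by auto
qed

lemma hole7I:
  assumes "{a, b, c, d, e, f, g} \<subseteq> V"
    and "F a b" "F b c" "F c d" "F d e" "F e f" "F f g" "F g a"
    and "\<not> F a c" "\<not> F a d" "\<not> F a e" "\<not> F a f" "\<not> F b d" "\<not> F b e" "\<not> F b f" "\<not> F b g"
    and "\<not> F c e" "\<not> F c f" "\<not> F c g" "\<not> F d f" "\<not> F d g" "\<not> F e g"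
  shows "\<exists>h. hole V 7 h"
proof -
  have *: "F b a" "F c b" "F d c" "F e d" "F f e" "F g f" "F a g"
    "\<not> F c a" "\<not> F d a" "\<not> F e a" "\<not> F f a" "\<not> F d b" "\<not> F e b" "\<not> F f b" "\<not> F g b"
    "\<not> F e c" "\<not> F f c" "\<not> F g c" "\<not> F f d" "\<not> F g d" "\<not> F g e"
    using assms by (auto dest: F_sym)
  have "hole V (int 7) (\<lambda>i. [a, b, c, d, e, f, g] ! nat (i mod int 7))"
  proof (rule hole_listI)
    fix x y :: nat
    assume "x < 7" "y < 7"
    then have "x \<in> {0, 1, 2, 3, 4, 5, 6}" "y \<in> {0, 1, 2, 3, 4, 5, 6}" by auto
    then show "F ([a, b, c, d, e, f, g] ! x) ([a, b, c, d, e, f, g] ! y) \<longleftrightarrow>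
        (int y - int x) mod int 7 \<in> {0, 1, int 7 - 1}"
      by (elim insertE emptyE; simp add: assms *)
  qed (use assms(1) in auto)
  then show ?thesis by auto
qed

text \<open>
  Since no vertex dominates another one, an induced path can be prolonged by a neighbour of its
  last vertex that is not adjacent to the last but one.  It closes up to a hole after at most
  seven vertices, because the path on seven vertices contains four independent ones.
\<close>

lemma ex_hole:
  assumes thin: "thin V" and "V \<noteq> {}"
    and dom: "\<And>u v. \<not> dominates V u v"
    and iso: "\<And>v. v \<in> V \<Longrightarrow> \<exists>w\<in>V. w \<noteq> v \<and> F v w"
  shows "(\<exists>h. hole V 6 h) \<or> (\<exists>h. hole V 7 h)"
proof (rule ccontr)
  assume "\<not> ?thesis"
  then have no6: "\<And>h. \<not> hole V 6 h" and no7: "\<And>h. \<not> hole V 7 h" by blast+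
  have next_vertex: "\<exists>w\<in>V. F v w \<and> \<not> F u w" if "u \<in> V" "v \<in> V" "u \<noteq> v" for u v
    using dom[of u v] that unfolding dominates_def by blast
  obtain a where a: "a \<in> V" using \<open>V \<noteq> {}\<close> by blast
  obtain b where b: "b \<in> V" "F a b" "b \<noteq> a" using iso[OF a] by blast
  obtain c where c: "c \<in> V" "F b c" "\<not> F a c" using next_vertex[of a b] a b by blast
  obtain d where d: "d \<in> V" "F c d" "\<not> F b d" using next_vertex[of b c] b c by blast
  \<comment> \<open>Each new vertex is unrelated to all earlier ones except its predecessor: a chord
    back would close an induced cycle of length 4 or 5, or later a hole of length 6 or 7.\<close>
  have da: "\<not> F a d" using thin_C4[OF thin, of a b c d] a b c d F_sym by blast
  obtain e where e: "e \<in> V" "F d e" "\<not> F c e" using next_vertex[of c d] c d by blast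
  have eb: "\<not> F b e" using thin_C4[OF thin, of b c d e] a b c d e F_sym by blast
  have ea: "\<not> F a e" using thin_C5[OF thin, of a b c d e] a b c d e da eb F_sym by blast
  obtain f where f: "f \<in> V" "F e f" "\<not> F d f" using next_vertex[of d e] d e by blast
  have fc: "\<not> F c f" using thin_C4[OF thin, of c d e f] c d e f F_sym by blast
  have fb: "\<not> F b f" using thin_C5[OF thin, of b c d e f] b c d e f eb fc F_sym by blast
  have fa: "\<not> F a f"
    using hole6I[of a b c d e f V] no6 a b c d e f da eb ea fc fb F_sym[of a f] by blast
  obtain g where g: "g \<in> V" "F f g" "\<not> F e g" using next_vertex[of e f] e f by blast
  have gd: "\<not> F d g" using thin_C4[OF thin, of d e f g] d e f g F_sym by blast
  have gc: "\<not> F c g" using thin_C5[OF thin, of c d e f g] c d e f g fc gd F_sym by blast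
  have gb: "\<not> F b g"
    using hole6I[of b c d e f g V] no6 b c d e f g eb fc fb gd gc F_sym[of b g] by blast
  have "\<not> F a g"
    using hole7I[of a b c d e f g V] no7 a b c d e f g da ea eb fa fb fc gb gc gd F_sym[of a g]
    by blast
  then show False
    using thin_K4[OF thin, of a c e g] a c e g ea gc by blast
qed

text \<open>If \<open>b\<close> never switches on between \<open>i - 1\<close> and \<open>i\<close>,
  truth propagates downwards, and by periodicity a single true value reaches every residue.\<close>

lemma ex_cut_or_all:
  fixes b :: "int \<Rightarrow> bool"
  assumes per: "\<And>i. b (i mod n) = b i" and n: "n > 0"
  shows "(\<forall>i. b i) \<or> (\<forall>i. \<not> b i) \<or> (\<exists>i. b i \<and> \<not> b (i - 1))"
proof (rule ccontr)
  assume neg: "\<not> ?thesis"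
  then have down: "b (i - 1)" if "b i" for i using that by blast
  have downs: "b (i - int k)" if "b i" for i k
    using that by (induction k) (auto dest: down simp: algebra_simps)
  obtain i j where ij: "b i" "\<not> b j" using neg by blast
  have "b (i - int (nat ((i - j) mod n)))" using downs ij by blast
  moreover have "(i - int (nat ((i - j) mod n))) mod n = j mod n"
    using n by (simp add: mod_diff_right_eq)
  ultimately show False using per ij by metis
qed

end

section \<open>Holes of length seven\<close>

locale thin_hole7 = reflexive_symmetric F for F :: "'a \<Rightarrow> 'a \<Rightarrow> bool" +
  fixes V :: "'a set" and h :: "int \<Rightarrow> 'a"
  assumes thin: "thin V" and hole: "hole V 7 h"
begin

section \<open>Traces of vertices on a 7-hole and the relations they force\<close>

lemma h_in [simp]: "h i \<in> V"
  using hole by (simp add: hole_def)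

lemma h_mod: "h (i mod 7) = h i"
  using hole by (simp add: hole_def)

lemma h_cong: "i mod 7 = j mod 7 \<Longrightarrow> h i = h j"
  using h_mod by metis

lemma h_F: "F (h i) (h j) \<longleftrightarrow> (j - i) mod 7 \<in> {0, 1, 6}"
  using hole by (simp add: hole_def)

text \<open>The trace of a vertex is the set of hole vertices related to it. Residue 6 stands for
  -1: a \<open>tri i\<close> trace is the interval from \<open>i - 1\<close> to
  \<open>i + 1\<close>, like that of \<open>h i\<close> itself, and a \<open>quad i\<close> trace
  runs from \<open>i - 1\<close> to \<open>i + 2\<close>.\<close>

definition tri :: "int \<Rightarrow> 'a \<Rightarrow> bool" where
  "tri i x \<longleftrightarrow> x \<in> V \<and> (\<forall>j. F x (h j) \<longleftrightarrow> (j - i) mod 7 \<in> {0, 1, 6})"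

definition quad :: "int \<Rightarrow> 'a \<Rightarrow> bool" where
  "quad i x \<longleftrightarrow> x \<in> V \<and> (\<forall>j. F x (h j) \<longleftrightarrow> (j - i) mod 7 \<in> {0, 1, 2, 6})"

lemma tri_h: "tri i (h i)"
  by (auto simp: tri_def h_F)

lemma tri_in: "tri i x \<Longrightarrow> x \<in> V" and quad_in: "quad i x \<Longrightarrow> x \<in> V"
  by (auto simp: tri_def quad_def)

lemma tri_F: "tri i x \<Longrightarrow> F x (h j) \<longleftrightarrow> (j - i) mod 7 \<in> {0, 1, 6}"
  and tri_F': "tri i x \<Longrightarrow> F (h j) x \<longleftrightarrow> (j - i) mod 7 \<in> {0, 1, 6}"
  by (auto simp: tri_def F_commute[of "h j"])

lemma quad_F: "quad i x \<Longrightarrow> F x (h j) \<longleftrightarrow> (j - i) mod 7 \<in> {0, 1, 2, 6}"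
  and quad_F': "quad i x \<Longrightarrow> F (h j) x \<longleftrightarrow> (j - i) mod 7 \<in> {0, 1, 2, 6}"
  by (auto simp: quad_def F_commute[of "h j"])

lemmas adj = h_F tri_F tri_F' quad_F quad_F' tri_in quad_in

lemma mod7_cases:
  fixes k :: int
  shows "k mod 7 \<in> {0, 1, 2, 3, 4, 5, 6}"
  by (simp; presburger)

lemma tri_cong: "i mod 7 = j mod 7 \<Longrightarrow> tri i x \<longleftrightarrow> tri j x"
  unfolding tri_def by (metis mod_diff_cong)

lemma quad_cong: "i mod 7 = j mod 7 \<Longrightarrow> quad i x \<longleftrightarrow> quad j x"
  unfolding quad_def by (metis mod_diff_cong)

text \<open>Expressing one index as the other plus a residue reduces every question about two types
  to finitely many concrete offsets.\<close>

lemma tri_shift: "(j - i) mod 7 = k \<Longrightarrow> tri j x \<Longrightarrow> tri (i + k) x"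
  using tri_cong[of j "i + k" x] by (auto simp: mod_add_right_eq)

lemma quad_shift: "(j - i) mod 7 = k \<Longrightarrow> quad j x \<Longrightarrow> quad (i + k) x"
  using quad_cong[of j "i + k" x] by (auto simp: mod_add_right_eq)

text \<open>Three independent hole vertices cannot all be unrelated to \<open>x\<close>, so the
  trace is not small. A gap of one or two vertices within it would close an induced cycle of length
  4 or 5. This leaves only intervals of three or four vertices and the whole hole.\<close>

lemma vertex_types:
  assumes x: "x \<in> V"
  shows "(\<forall>i. F x (h i)) \<or> (\<exists>i. tri i x) \<or> (\<exists>i. quad i x)"
proof -
  have "\<not> (\<forall>i. \<not> F x (h i))"
    using thin_K4[OF thin x, of "h 0" "h 2" "h 4"] by (auto simp: h_F)
  then consider "\<forall>i. F x (h i)" | i where "F x (h i)" "\<not> F x (h (i - 1))"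
    using ex_cut_or_all[of "\<lambda>i. F x (h i)" 7] by (auto simp: h_mod)
  then show ?thesis
  proof cases
    case 1
    then show ?thesis by blast
  next
    case 2
    have C4: "F x (h (j + 1))" if "F x (h j)" "F x (h (j + 2))" for j
      using thin_C4[OF thin x, of "h j" "h (j + 1)" "h (j + 2)"] that by (auto simp: h_F F_commute)
    have C5: "F x (h (j + 1)) \<or> F x (h (j + 2))" if "F x (h j)" "F x (h (j + 3))" for j
      using thin_C5[OF thin x, of "h j" "h (j + 1)" "h (j + 2)" "h (j + 3)"] that
      by (auto simp: h_F F_commute)
    have h7: "h (i + 7) = h i" "h (i + 6) = h (i - 1)"
      using h_cong[OF mod_add_self2, of i] h_cong[OF mod_add_self2, of "i - 1"] by (simp_all add: add.commute)
    have n6: "\<not> F x (h (i + 6))" using 2 h7 by simp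
    have n5: "\<not> F x (h (i + 5))" using C4[of "i + 5"] 2 n6 h7 by (auto simp: add.commute)
    have n4: "\<not> F x (h (i + 4))" using C5[of "i + 4"] 2 n5 n6 h7 by (auto simp: add.commute)
    have p1: "F x (h (i + 1))"
      using thin_K4[OF thin x, of "h (i + 1)" "h (i + 3)" "h (i + 6)"] C4[of i] C5[of i] 2 n6
      by (auto simp: h_F)
    have p2: "F x (h (i + 2))"
      using thin_K4[OF thin x, of "h (i + 2)" "h (i + 4)" "h (i + 6)"] n4 n6
      by (auto simp: h_F)
    have eq: "F x (h j) \<longleftrightarrow> F x (h (i + (j - i) mod 7))" for j
      using h_mod[of j] h_mod[of "i + (j - i) mod 7"] by (simp add: mod_add_right_eq)
    \<comment> \<open>The trace starts at \<open>h i\<close> and only \<open>h (i + 3)\<close> is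
      undecided; since \<open>tri\<close> and \<open>quad\<close> are indexed by the second vertex
      of the trace, the index is \<open>i + 1\<close>.\<close>
    show ?thesis
    proof (cases "F x (h (i + 3))")
      case True
      have "quad (i + 1) x"
        unfolding quad_def
      proof (intro conjI allI x)
        fix j
        have "(j - (i + 1)) mod 7 = ((j - i) mod 7 - 1) mod 7"
          by (simp add: mod_diff_left_eq algebra_simps)
        then show "F x (h j) \<longleftrightarrow> (j - (i + 1)) mod 7 \<in> {0, 1, 2, 6}"
          using mod7_cases[of "j - i"] 2 p1 p2 True n4 n5 n6 eq[of j] by (elim insertE) auto
      qed
      then show ?thesis by blast
    next
      case False
      have "tri (i + 1) x"
        unfolding tri_def
      proof (intro conjI allI x)
        fix j
        have "(j - (i + 1)) mod 7 = ((j - i) mod 7 - 1) mod 7"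
          by (simp add: mod_diff_left_eq algebra_simps)
        then show "F x (h j) \<longleftrightarrow> (j - (i + 1)) mod 7 \<in> {0, 1, 6}"
          using mod7_cases[of "j - i"] 2 p1 p2 False n4 n5 n6 eq[of j] by (elim insertE) auto
      qed
      then show ?thesis by blast
    qed
  qed
qed

text \<open>This is applied later to a second 7-hole, with a vertex of the first one as
  \<open>x\<close>.\<close>

lemma three_consecutive:
  assumes "x \<in> V"
  shows "\<exists>i. F x (h (i - 1)) \<and> F x (h i) \<and> F x (h (i + 1))"
  using vertex_types[OF assms]
proof (elim disjE exE)
  fix i
  assume "tri i x"
  then show ?thesis by (intro exI[of _ i]) (simp add: adj)
next
  fix i
  assume "quad i x"
  then show ?thesis by (intro exI[of _ i]) (simp add: adj)
qed blast

text \<open>Equal indices are related by the absence of induced 4-cycles, neighbouring ones by the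
  absence of four independent vertices; a relation at distance 3 would close an induced 4-cycle.
  Distance 2 remains undecided and gives rise to \<open>bridged\<close>.\<close>

lemma tri_tri:
  assumes "tri i x" "tri j y"
  shows "(j - i) mod 7 \<in> {0, 1, 6} \<Longrightarrow> F x y"
    and "(j - i) mod 7 \<in> {3, 4} \<Longrightarrow> \<not> F x y"
proof -
  have eq: "F x y" if "tri i x" "tri i y" for i x y
    using thin_C4[OF thin, of x "h (i - 1)" y "h (i + 1)"] that by (simp add: adj)
  have succ: "F x y" if "tri i x" "tri (i + 1) y" for i x y
    using thin_K4[OF thin, of x y "h (i + 3)" "h (i + 5)"] that by (simp add: adj)
  have far: "\<not> F x y" if "tri i x" "tri (i + 3) y" for i x y
    using thin_C4[OF thin, of x y "h (i + 2)" "h (i + 1)"] that by (auto simp: adj)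
  have opposite: "tri (j + (- (j - i)) mod 7) x"
    using tri_shift[of i j "(- (j - i)) mod 7" x] assms(1) by simp
  show "F x y" if d: "(j - i) mod 7 \<in> {0, 1, 6}"
  proof -
    have "(- (j - i)) mod 7 = 1" if "(j - i) mod 7 = 6" using that by presburger
    then show ?thesis
      using d tri_shift[OF refl assms(2), of i] opposite assms eq[of i x y] succ[of i x y] succ[of j y x]
      by (auto simp: F_commute[of y x])
  qed
  show "\<not> F x y" if d: "(j - i) mod 7 \<in> {3, 4}"
  proof -
    have "(- (j - i)) mod 7 = 3" if "(j - i) mod 7 = 4" using that by presburger
    then show ?thesis
      using d tri_shift[OF refl assms(2), of i] opposite assms far[of i x y] far[of j y x]
      by (auto simp: F_commute[of y x])
  qed
qed

text \<open>Here distance 2 is decided too: the longer traces let such a relation close an induced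
  5-cycle.\<close>

lemma quad_quad:
  assumes "quad i x" "quad j y"
  shows "(j - i) mod 7 \<in> {0, 1, 6} \<Longrightarrow> F x y"
    and "(j - i) mod 7 \<in> {2, 3, 4, 5} \<Longrightarrow> \<not> F x y"
proof -
  have eq: "F x y" if "quad i x" "quad i y" for i x y
    using thin_C4[OF thin, of x "h (i - 1)" y "h (i + 1)"] that by (simp add: adj)
  have succ: "F x y" if "quad i x" "quad (i + 1) y" for i x y
    using thin_C4[OF thin, of x "h i" y "h (i + 2)"] that by (simp add: adj)
  have far2: "\<not> F x y" if "quad i x" "quad (i + 2) y" for i x y
    using thin_C5[OF thin, of x y "h (i + 4)" "h (i + 5)" "h (i + 6)"] that by (auto simp: adj)
  have far3: "\<not> F x y" if "quad i x" "quad (i + 3) y" for i x y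
    using thin_C4[OF thin, of x y "h (i + 5)" "h (i + 6)"] that by (auto simp: adj)
  have opposite: "quad (j + (- (j - i)) mod 7) x"
    using quad_shift[of i j "(- (j - i)) mod 7" x] assms(1) by simp
  show "F x y" if d: "(j - i) mod 7 \<in> {0, 1, 6}"
  proof -
    have "(- (j - i)) mod 7 = 1" if "(j - i) mod 7 = 6" using that by presburger
    then show ?thesis
      using d quad_shift[OF refl assms(2), of i] opposite assms eq[of i x y] succ[of i x y]
        succ[of j y x]
      by (auto simp: F_commute[of y x])
  qed
  show "\<not> F x y" if d: "(j - i) mod 7 \<in> {2, 3, 4, 5}"
  proof -
    have "(- (j - i)) mod 7 = 3" if "(j - i) mod 7 = 4" using that by presburger
    moreover have "(- (j - i)) mod 7 = 2" if "(j - i) mod 7 = 5" using that by presburger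
    ultimately show ?thesis
      using d quad_shift[OF refl assms(2), of i] opposite assms far2[of i x y] far2[of j y x]
        far3[of i x y] far3[of j y x]
      by (auto simp: F_commute[of y x])
  qed
qed

text \<open>Offsets 2 and 6, the two ends of the \<open>quad\<close> trace, remain
  undecided.\<close>

lemma quad_tri:
  assumes "quad i x" "tri j y"
  shows "(j - i) mod 7 \<in> {0, 1} \<Longrightarrow> F x y"
    and "(j - i) mod 7 \<in> {3, 4, 5} \<Longrightarrow> \<not> F x y"
proof -
  have y: "tri (i + (j - i) mod 7) y"
    using tri_shift[OF refl assms(2)] .
  show "F x y" if "(j - i) mod 7 \<in> {0, 1}"
    using thin_C4[OF thin, of x "h (i - 1)" y "h (i + 1)"] thin_C4[OF thin, of x "h i" y "h (i + 2)"]
      that y assms(1) by (auto simp: adj)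
  have n3: "\<not> F x y" if "tri (i + 3) y"
    using thin_C5[OF thin, of x y "h (i + 4)" "h (i + 5)" "h (i + 6)"] that assms(1)
    by (auto simp: adj)
  have n4: "\<not> F x y" if "tri (i + 4) y"
    using thin_C4[OF thin, of x y "h (i + 3)" "h (i + 2)"] that assms(1) by (auto simp: adj)
  have n5: "\<not> F x y" if "tri (i + 5) y"
    using thin_C5[OF thin, of x y "h (i + 4)" "h (i + 3)" "h (i + 2)"] that assms(1)
    by (auto simp: adj)
  show "\<not> F x y" if "(j - i) mod 7 \<in> {3, 4, 5}"
    using that y n3 n4 n5 by auto
qed

section \<open>The cyclic family of cliques around a 7-hole\<close>

definition S :: "int \<Rightarrow> 'a set" where
  "S i = {x. tri i x \<or> tri (i + 1) x \<or> quad i x}"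

lemma S_subset: "S i \<subseteq> V"
  by (auto simp: S_def tri_in quad_in)

lemma S_clique: "clique (S i)"
  unfolding clique_def S_def
  by (auto intro: tri_tri(1) quad_quad(1) quad_tri(1) F_sym[OF quad_tri(1)])

text \<open>\<open>h (i + 3)\<close> separates the two cliques: it is related to all of
  \<open>S (i + 2)\<close> and to nothing in \<open>S i\<close>.\<close>

lemma S_disjoint: "S i \<inter> S (i + 2) = {}"
proof -
  have "\<not> F x (h (i + 3))" if "x \<in> S i" for x
    using that by (auto simp: S_def adj)
  moreover have "F x (h (i + 3))" if "x \<in> S (i + 2)" for x
    using that by (auto simp: S_def adj)
  ultimately show ?thesis by blast
qed

lemma S_cong: "i mod 7 = j mod 7 \<Longrightarrow> S i = S j"
  using tri_cong[of i j] tri_cong[of "i + 1" "j + 1"] quad_cong[of i j]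
  by (simp add: S_def mod_add_cong)

lemma S_linked:
  "(\<lambda>T U. T \<in> range S \<and> U \<in> range S \<and> T \<inter> U = {})\<^sup>*\<^sup>* (S i) (S j)"
proof -
  let ?R = "\<lambda>T U. T \<in> range S \<and> U \<in> range S \<and> T \<inter> U = {}"
  have "?R\<^sup>*\<^sup>* (S i) (S (i + 2 * int k))" for k
  proof (induction k)
    case 0 then show ?case by simp
  next
    case (Suc k)
    have "?R (S (i + 2 * int k)) (S (i + 2 * int (Suc k)))"
      using S_disjoint[of "i + 2 * int k"] by (auto simp: algebra_simps)
    then show ?case by (rule rtranclp.rtrancl_into_rtrancl[OF Suc])
  qed
  \<comment> \<open>4 is the inverse of 2 modulo 7, so this many steps of length 2 lead from
    \<open>i\<close> to \<open>j\<close>.\<close>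
  from this[of "nat ((4 * (j - i)) mod 7)"]
  have "?R\<^sup>*\<^sup>* (S i) (S (i + 2 * ((4 * (j - i)) mod 7)))" by simp
  moreover have "S (i + 2 * ((4 * (j - i)) mod 7)) = S j"
  proof (rule S_cong)
    have "(i + 2 * ((4 * (j - i)) mod 7)) mod 7 = (i + 2 * (4 * (j - i))) mod 7"
      by (metis mod_add_right_eq mod_mult_right_eq)
    also have "i + 2 * (4 * (j - i)) = j + (j - i) * 7" by simp
    also have "\<dots> mod 7 = j mod 7" by (rule mod_mult_self1)
    finally show "(i + 2 * ((4 * (j - i)) mod 7)) mod 7 = j mod 7" .
  qed
  ultimately show ?thesis by simp
qed

end

locale reduced_hole7 = thin_hole7 F V h for F :: "'a \<Rightarrow> 'a \<Rightarrow> bool" and V h +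
  assumes undominated: "\<not> dominates V u v"
begin

lemma mod7_flip: "(j - i) mod 7 = (- ((i - j) mod 7)) mod 7" for i j :: int
  by (simp add: mod_minus_eq)

lemma mod7_diff: "(j - k) mod 7 \<in> A \<Longrightarrow> \<exists>d\<in>A. k mod 7 = (j - d) mod 7" for j k :: int
  by (auto intro!: bexI simp: mod_diff_right_eq)

lemma tri_minus: "tri (i + (7 - k)) x \<Longrightarrow> tri (i - k) x"
  using tri_cong[OF mod_add_self2, of "i - k" x] by (simp add: algebra_simps)

lemma private_neighbor:
  assumes "u \<in> V" "v \<in> V" "u \<noteq> v"
  shows "\<exists>w\<in>V. F v w \<and> \<not> F u w"
  using undominated[of u v] assms by (auto simp: dominates_def)

text \<open>If \<open>x\<close> were related to the whole hole, some \<open>w\<close> would still be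
  unrelated to \<open>x\<close>, because \<open>x\<close> does not dominate \<open>h 0\<close>. Two
  unrelated hole vertices in the trace of \<open>w\<close> would then form an induced 4-cycle with
  \<open>x\<close> and \<open>w\<close>.\<close>

lemma vertex_cases:
  assumes x: "x \<in> V"
  obtains i where "tri i x" | i where "quad i x"
proof -
  have "\<not> (\<forall>i. F x (h i))"
  proof
    assume all: "\<forall>i. F x (h i)"
    have x0: "x \<noteq> h 0" using all h_F[of 0 2] by auto
    obtain w where w: "w \<in> V" "\<not> F x w" using private_neighbor[OF x h_in x0] by blast
    have C4: "False" if "\<not> F (h j) (h k)" "F w (h j)" "F w (h k)" for j k
      using thin_C4[OF thin x h_in w(1) h_in, of j k] all w(2) that by (auto simp: F_commute)
    from vertex_types[OF w(1)] show False
    proof (elim disjE exE)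
      assume "\<forall>i. F w (h i)"
      then show False using C4[of 0 2] by (auto simp: h_F)
    next
      fix i
      assume "tri i w"
      then show False using C4[of "i - 1" "i + 1"] by (simp add: adj)
    next
      fix i
      assume "quad i w"
      then show False using C4[of "i - 1" "i + 1"] by (simp add: adj)
    qed
  qed
  then show ?thesis using vertex_types[OF x] that by blast
qed

text \<open>Outside \<open>S i\<close>, the vertices related to \<open>h i\<close> form two cliques
  with no relation between them. A 7-hole there would have three consecutive vertices related to
  \<open>h i\<close>, that is, an induced path on three vertices inside such a union.\<close>

lemma no_hole_outside: "\<not> hole (V - S i) 7 g"
proof
  assume g: "hole (V - S i) 7 g"
  then have gV: "hole V 7 g" by (rule hole_mono) blast
  interpret g: thin_hole7 F V g
    by unfold_locales (use thin gV in auto)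
  obtain k where k: "F (h i) (g (k - 1))" "F (h i) (g k)" "F (h i) (g (k + 1))"
    using g.three_consecutive[OF h_in] by blast
  \<comment> \<open>Modulo 7, \<open>i + 6\<close> and \<open>i + 5\<close> are \<open>i - 1\<close>
    and \<open>i - 2\<close>; the right-hand side consists of \<open>quad (i + 1)\<close> alone,
    because \<open>tri (i + 1)\<close> belongs to \<open>S i\<close>.\<close>
  define left where "left y \<longleftrightarrow> tri (i + 6) y \<or> quad (i + 6) y \<or> quad (i + 5) y" for y
  have sides: "left y \<or> quad (i + 1) y" if "y \<in> V - S i" "F (h i) y" for y
  proof -
    have "y \<in> V" using that by blast
    then show ?thesis
    proof (cases rule: vertex_cases)
      case (1 j)
      then have "tri (i + (j - i) mod 7) y" by (intro tri_shift) auto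
      moreover have "(i - j) mod 7 \<in> {0, 1, 6}" using 1 that by (auto simp: adj)
      then have "(j - i) mod 7 \<in> {0, 1, 6}" using mod7_flip[of j i] by auto
      ultimately show ?thesis using that by (auto simp: S_def left_def)
    next
      case (2 j)
      then have "quad (i + (j - i) mod 7) y" by (intro quad_shift) auto
      moreover have "(i - j) mod 7 \<in> {0, 1, 2, 6}" using 2 that by (auto simp: adj)
      then have "(j - i) mod 7 \<in> {0, 1, 5, 6}" using mod7_flip[of j i] by auto
      ultimately show ?thesis using that by (auto simp: S_def left_def)
    qed
  qed
  have left: "F y z" if "left y" "left z" for y z
    using that unfolding left_def
    by (auto intro: tri_tri(1) quad_quad(1) quad_tri(1) F_sym[OF quad_tri(1)])
  have right: "F y z" if "quad (i + 1) y" "quad (i + 1) z" for y z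
    using that by (auto intro: quad_quad(1))
  have across: "\<not> F y z" if "left y" "quad (i + 1) z" for y z
    using that quad_tri(2)[of "i + 1" z "i + 6" y] quad_quad(2)[of "i + 1" z "i + 6" y]
      quad_quad(2)[of "i + 1" z "i + 5" y]
    unfolding left_def by (auto simp: F_commute[of y z])
  have gi: "g j \<in> V - S i" for j using g by (simp add: hole_def)
  have "F (g (k - 1)) (g k)" "F (g k) (g (k + 1))" "\<not> F (g (k - 1)) (g (k + 1))"
    by (simp_all add: g.h_F)
  then show False
    using sides[OF gi k(1)] sides[OF gi k(2)] sides[OF gi k(3)] left right across
    by (metis F_commute)
qed

section \<open>Positions of \<open>quad\<close> vertices and of bridges\<close>

definition has_quad :: "int \<Rightarrow> bool" where
  "has_quad i \<longleftrightarrow> (\<exists>x. quad i x)"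

text \<open>Records the relations left open by \<open>tri_tri\<close>, those that jump over
  \<open>h i\<close>.\<close>

definition bridged :: "int \<Rightarrow> bool" where
  "bridged i \<longleftrightarrow> (\<exists>x y. tri (i - 1) x \<and> tri (i + 1) y \<and> F x y)"

lemma bridgedI: "tri (i - 1) x \<Longrightarrow> tri (i + 1) y \<Longrightarrow> F x y \<Longrightarrow> bridged i"
  by (auto simp: bridged_def)

lemma has_quad_cong: "i mod 7 = j mod 7 \<Longrightarrow> has_quad i \<longleftrightarrow> has_quad j"
  unfolding has_quad_def using quad_cong[of i j] by blast

lemma bridged_cong: "i mod 7 = j mod 7 \<Longrightarrow> bridged i \<longleftrightarrow> bridged j"
  unfolding bridged_def
  using tri_cong[of "i - 1" "j - 1"] tri_cong[of "i + 1" "j + 1"]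
  by (simp add: mod_diff_cong mod_add_cong)

text \<open>A \<open>quad\<close> vertex and a bridge both shorten the way around the hole by one.
  Two such shortcuts three positions apart combine into an induced 5-cycle; this is behind all the
  exclusions that follow, and distance 4 is distance 3 seen from the other end.\<close>

lemma has_quad_has_quad3: "has_quad i \<Longrightarrow> \<not> has_quad (i + 3)"
proof
  assume "has_quad i" "has_quad (i + 3)"
  then obtain b c where bc: "quad i b" "quad (i + 3) c" by (auto simp: has_quad_def)
  then show False
    using thin_C5[OF thin, of "h (i - 1)" b "h (i + 2)" c "h (i + 5)"] quad_quad(2)[OF bc]
    by (simp add: adj)
qed

lemma has_quad_has_quad4: "has_quad i \<Longrightarrow> \<not> has_quad (i + 4)"
  using has_quad_has_quad3[of "i + 4"] has_quad_cong[of "i + 7" i] by (auto simp: add.commute)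

lemma bridged_has_quad3: "bridged i \<Longrightarrow> \<not> has_quad (i + 3)"
proof
  assume "bridged i" "has_quad (i + 3)"
  then obtain x y b where xy: "tri (i - 1) x" "tri (i + 1) y" "F x y" and b: "quad (i + 3) b"
    by (auto simp: has_quad_def bridged_def)
  then show False
    using thin_C5[OF thin, of x y "h (i + 2)" b "h (i - 2)"]
      quad_tri(2)[OF b xy(1)] quad_tri(2)[OF b xy(2)]
    by (simp add: adj F_commute[of _ b])
qed

lemma has_quad_bridged4: "has_quad i \<Longrightarrow> \<not> bridged (i + 4)"
  using bridged_has_quad3[of "i + 4"] has_quad_cong[of "i + 7" i] by (auto simp: add.commute)

lemma bridged_bridged3: "bridged i \<Longrightarrow> \<not> bridged (i + 3)"
proof
  assume "bridged i" "bridged (i + 3)"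
  then obtain x y u v where xy: "tri (i - 1) x" "tri (i + 1) y" "F x y"
    and uv': "tri (i + 3 - 1) u" "tri (i + 3 + 1) v" "F u v"
    unfolding bridged_def by blast
  then have uv: "tri (i + 2) u" "tri (i + 4) v" "F u v" by (simp_all add: algebra_simps)
  have n: "\<not> F x u" "\<not> F y v" and yu: "F y u"
    using tri_tri(2)[OF xy(1) uv(1)] tri_tri(2)[OF xy(2) uv(2)] tri_tri(1)[OF xy(2) uv(1)] by auto
  have V: "x \<in> V" "y \<in> V" "u \<in> V" "v \<in> V" using xy uv by (auto simp: tri_in)
  have "\<not> F x v"
    using thin_C4[OF thin V] xy uv n yu by (auto simp: F_commute[of x v])
  then show False
    using thin_C5[OF thin V, of "h (i + 5)"] xy uv n yu by (simp add: adj)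
qed

lemma bridged_bridged4: "bridged i \<Longrightarrow> \<not> bridged (i + 4)"
  using bridged_bridged3[of "i + 4"] bridged_cong[of "i + 7" i] by (auto simp: add.commute)

text \<open>As \<open>h i\<close> does not dominate \<open>x\<close>, some \<open>y\<close> is
  related to \<open>x\<close> but not to \<open>h i\<close>. Every type except \<open>tri\<close> at
  distance 2 is either related to \<open>h i\<close> or unrelated to \<open>x\<close>.\<close>

lemma tri_neighbor:
  assumes x: "tri i x" "x \<noteq> h i"
  shows "\<exists>y. F x y \<and> (tri (i + 2) y \<or> tri (i - 2) y)"
proof -
  obtain y where y: "y \<in> V" "F x y" "\<not> F (h i) y"
    using private_neighbor[of "h i" x] x by (auto simp: tri_in)
  from y(1) show ?thesis
  proof (cases rule: vertex_cases)
    case (1 j)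
    have t: "tri (i + (j - i) mod 7) y" using 1 by (intro tri_shift) auto
    have "(j - i) mod 7 \<notin> {0, 1, 6}" using tri_tri(1)[OF tri_h[of i] 1] y by auto
    moreover have "(j - i) mod 7 \<notin> {3, 4}" using tri_tri(2)[OF x(1) 1] y by auto
    ultimately have "(j - i) mod 7 = 2 \<or> (j - i) mod 7 = 5" using mod7_cases[of "j - i"] by auto
    then show ?thesis using t y tri_minus[of i 2] by auto
  next
    case (2 j)
    have "(i - j) mod 7 \<notin> {0, 1, 2, 6}" using y(3) quad_F'[OF 2, of i] by simp
    moreover have "(i - j) mod 7 \<notin> {3, 4, 5}"
      using quad_tri(2)[OF 2 x(1)] F_sym[OF y(2)] by auto
    ultimately show ?thesis using mod7_cases[of "i - j"] by auto
  qed
qed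

lemma quad_private_neighbor:
  assumes bc: "quad i b" "quad i c" "b \<noteq> c"
  shows "\<exists>w. F c w \<and> \<not> F b w \<and> (tri (i + 2) w \<or> tri (i - 1) w)"
proof -
  obtain w where w: "w \<in> V" "F c w" "\<not> F b w"
    using private_neighbor[of b c] bc by (auto simp: quad_in)
  from w(1) show ?thesis
  proof (cases rule: vertex_cases)
    case (1 j)
    have t: "tri (i + (j - i) mod 7) w" using 1 by (intro tri_shift) auto
    have "(j - i) mod 7 \<notin> {0, 1}" using quad_tri(1)[OF bc(1) 1] w by auto
    moreover have "(j - i) mod 7 \<notin> {3, 4, 5}" using quad_tri(2)[OF bc(2) 1] w by auto
    ultimately have "(j - i) mod 7 = 2 \<or> (j - i) mod 7 = 6" using mod7_cases[of "j - i"] by auto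
    then show ?thesis using t w tri_minus[of i 1] by auto
  next
    case (2 j)
    have "(j - i) mod 7 \<notin> {0, 1, 6}" using quad_quad(1)[OF bc(1) 2] w by auto
    moreover have "(j - i) mod 7 \<notin> {2, 3, 4, 5}" using quad_quad(2)[OF bc(2) 2] w by auto
    ultimately show ?thesis using mod7_cases[of "j - i"] by auto
  qed
qed

text \<open>The private neighbours of \<open>b\<close> and \<open>c\<close> are unrelated, since
  otherwise they would form an induced 4-cycle with \<open>b\<close> and \<open>c\<close>. So they
  lie at opposite ends of the trace; \<open>b\<close> and \<open>c\<close> may have to be exchanged
  to fix which end belongs to which.\<close>

lemma quad_distinct_neighbors:
  assumes "quad i b" "quad i c" "b \<noteq> c"
  shows "\<exists>b c z w. quad i b \<and> quad i c \<and> F b z \<and> F c w \<and>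
    tri (i + 2) z \<and> z \<noteq> h (i + 2) \<and> tri (i - 1) w \<and> w \<noteq> h (i - 1)"
proof -
  obtain w where w: "F c w" "\<not> F b w" "tri (i + 2) w \<or> tri (i - 1) w"
    using quad_private_neighbor[OF assms] by blast
  obtain z where z: "F b z" "\<not> F c z" "tri (i + 2) z \<or> tri (i - 1) z"
    using quad_private_neighbor[of i c b] assms by blast
  have V: "b \<in> V" "c \<in> V" "w \<in> V" "z \<in> V" using assms w z by (auto simp: quad_in tri_in)
  have "F b c" using quad_quad(1)[OF assms(1,2)] by simp
  then have "\<not> F w z"
    using thin_C4[OF thin V] w z by (auto simp: F_commute[of z b] F_commute[of c z])
  then have "(tri (i + 2) z \<and> tri (i - 1) w) \<or> (tri (i + 2) w \<and> tri (i - 1) z)"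
    using tri_tri(1)[of "i + 2" w "i + 2" z] tri_tri(1)[of "i - 1" w "i - 1" z] w z by auto
  moreover have "w \<noteq> h (i + 2)" "w \<noteq> h (i - 1)" "z \<noteq> h (i + 2)" "z \<noteq> h (i - 1)"
    using w(2) z(2) quad_F[OF assms(1)] quad_F[OF assms(2)] by auto
  ultimately show ?thesis using assms w z by blast
qed

text \<open>From two such vertices, \<open>z\<close> and \<open>w\<close> at the two ends continue
  by \<open>tri_neighbor\<close>. Without a bridge at \<open>i + 1\<close>, \<open>z\<close> yields
  one at \<open>i + 3\<close>, which excludes one at \<open>i\<close>; hence \<open>w\<close> leads
  away to \<open>v\<close> at \<open>i - 3\<close>, and \<open>v\<close>, \<open>w\<close>,
  \<open>c\<close>, \<open>h (i + 2)\<close>, \<open>h (i + 3)\<close> is an induced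
  5-cycle.\<close>

lemma quad_unique_right:
  assumes "quad i b" "quad i c" "\<not> bridged (i + 1)"
  shows "b = c"
proof (rule ccontr)
  assume "b \<noteq> c"
  then obtain c z w where c: "quad i c" "F c w" and z: "tri (i + 2) z" "z \<noteq> h (i + 2)"
    and w: "tri (i - 1) w" "w \<noteq> h (i - 1)"
    using quad_distinct_neighbors[OF assms(1,2)] by blast
  obtain y where y: "F z y" "tri (i + 4) y \<or> tri i y"
    using tri_neighbor[OF z] by (auto simp: algebra_simps)
  have "\<not> tri i y"
    using bridgedI[of "i + 1" y z] z(1) assms(3) F_sym[OF y(1)] by (auto simp: algebra_simps)
  then have "bridged (i + 3)"
    using y z(1) bridgedI[of "i + 3" z y] by (auto simp: algebra_simps)
  then have "\<not> bridged i" using bridged_bridged3[of i] by blast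
  moreover obtain v where v: "F w v" "tri (i + 1) v \<or> tri (i - 3) v"
    using tri_neighbor[OF w] by (auto simp: algebra_simps)
  ultimately have v': "tri (i - 3) v"
    using w(1) bridgedI[of i w v] by blast
  have vi: "v \<in> V" "w \<in> V" "c \<in> V" using v' w c by (auto simp: tri_in quad_in)
  have "\<not> F v c" using quad_tri(2)[OF c(1) v'] by (simp add: F_commute)
  then show False
    using thin_C5[OF thin vi, of "h (i + 2)" "h (i + 3)"] F_sym[OF v(1)] F_sym[OF c(2)]
      tri_F[OF v'] tri_F'[OF v'] tri_F[OF w(1)] quad_F[OF c(1)] h_F[of "i + 2" "i + 3"] by simp
qed

text \<open>The preceding argument reflected so that \<open>h i\<close> and \<open>h (i + 1)\<close>
  change places.\<close>

lemma quad_unique_left: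
  assumes "quad i b" "quad i c" "\<not> bridged i"
  shows "b = c"
proof (rule ccontr)
  assume "b \<noteq> c"
  then obtain b z w where b: "quad i b" "F b z" and z: "tri (i + 2) z" "z \<noteq> h (i + 2)"
    and w: "tri (i - 1) w" "w \<noteq> h (i - 1)"
    using quad_distinct_neighbors[OF assms(1,2)] by blast
  obtain y where y: "F w y" "tri (i + 1) y \<or> tri (i - 3) y"
    using tri_neighbor[OF w] by (auto simp: algebra_simps)
  have "\<not> tri (i + 1) y"
    using bridgedI[of i w y] w(1) assms(3) y(1) by blast
  then have "bridged (i - 2)"
    using y w(1) bridgedI[of "i - 2" y w] F_sym[OF y(1)] by auto
  then have "\<not> bridged (i + 1)" using bridged_bridged3[of "i - 2"] by (simp add: add.commute)
  moreover obtain v where v: "F z v" "tri (i + 4) v \<or> tri i v"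
    using tri_neighbor[OF z] by (auto simp: algebra_simps)
  ultimately have v': "tri (i + 4) v"
    using z(1) bridgedI[of "i + 1" v z] F_sym[OF v(1)] by (auto simp: algebra_simps)
  have vi: "v \<in> V" "z \<in> V" "b \<in> V" using v' z b by (auto simp: tri_in quad_in)
  have "\<not> F v b" using quad_tri(2)[OF b(1) v'] by (simp add: F_commute)
  then show False
    using thin_C5[OF thin vi, of "h (i - 1)" "h (i - 2)"] F_sym[OF v(1)] F_sym[OF b(2)]
      tri_F[OF v'] tri_F'[OF v'] tri_F[OF z(1)] quad_F[OF b(1)] h_F[of "i - 1" "i - 2"] by simp
qed

text \<open>
  A class containing \<open>h j\<close> that is not contained in any \<open>S i\<close> has a \<open>quad\<close> vertex or joins both
  sides of \<open>h j\<close>.  The distances forbidden between \<open>quad\<close> positions and bridged positions leave too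
  few \<open>quad\<close> vertices for all the classes of hole vertices to be of this kind.
\<close>

lemma class_within_S:
  assumes f: "proper V C f"
  shows "\<exists>i j. \<forall>v\<in>V. f v = f (h j) \<longrightarrow> v \<in> S i"
proof (rule ccontr)
  assume neg: "\<not> ?thesis"
  \<comment> \<open>A class of \<open>h j\<close> without \<open>quad\<close> vertices has only
    \<open>tri\<close> vertices at \<open>j - 1\<close>, \<open>j\<close>, \<open>j + 1\<close>. Not
    fitting into \<open>S (j - 1)\<close> or \<open>S j\<close>, it contains both outer types, which
    then bridge \<open>j\<close>.\<close>
  have wide: "\<exists>v k. quad k v \<and> f v = f (h j) \<and> (j - k) mod 7 \<in> {0, 1, 2, 6}"
    if nb: "\<not> bridged j" for j
  proof (rule ccontr)
    assume nq: "\<not> ?thesis"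
    have type: "tri (j - 1) v \<or> tri j v \<or> tri (j + 1) v" if v: "v \<in> V" "f v = f (h j)" for v
    proof -
      have Fv: "F v (h j)" using proper_F[OF f v(1) h_in v(2)] .
      from v(1) show ?thesis
      proof (cases rule: vertex_cases)
        case (1 k)
        have d: "(j - k) mod 7 \<in> {0, 1, 6}" using tri_F[OF 1] Fv by blast
        have "k mod 7 = j mod 7 \<or> k mod 7 = (j - 1) mod 7 \<or> k mod 7 = (j + 1) mod 7"
        proof -
          have "k mod 7 = (j - 0) mod 7 \<or> k mod 7 = (j - 1) mod 7 \<or> k mod 7 = (j - 6) mod 7"
            using mod7_diff[OF d] by simp
          then show ?thesis using mod_add_self2[of "j - 6" 7] by (simp add: add.commute)
        qed
        then show ?thesis using 1 tri_cong by blast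
      next
        case (2 k)
        then show ?thesis using nq v quad_F[OF 2] Fv by blast
      qed
    qed
    have "v \<in> S (j - 1)" if "v \<in> V" "f v = f (h j)" "\<not> tri (j + 1) v" for v
      using type[OF that(1,2)] that(3) by (auto simp: S_def)
    then obtain v where v: "v \<in> V" "f v = f (h j)" "tri (j + 1) v"
      using neg by blast
    have "w \<in> S j" if "w \<in> V" "f w = f (h j)" "\<not> tri (j - 1) w" for w
      using type[OF that(1,2)] that(3) by (auto simp: S_def)
    then obtain w where w: "w \<in> V" "f w = f (h j)" "tri (j - 1) w"
      using neg by blast
    have "F w v" using proper_F[OF f w(1) v(1)] v w by simp
    then show False using nb v w by (auto simp: bridged_def)
  qed
  \<comment> \<open>Position \<open>m + 4\<close> cannot be bridged, so the class of
    \<open>h (m + 4)\<close> has a \<open>quad\<close> vertex; of its four possible positions,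
    \<open>m + 3\<close> and \<open>m + 4\<close> are excluded by \<open>m\<close>.\<close>
  have step: "has_quad (m + 2) \<or> has_quad (m + 5)" if m: "has_quad m" for m
  proof -
    obtain v k where k: "quad k v" "(m + 4 - k) mod 7 \<in> {0, 1, 2, 6}"
      using wide[OF has_quad_bridged4[OF m]] by metis
    then have hk: "has_quad k" by (auto simp: has_quad_def)
    have "k mod 7 = (m + 4 - 0) mod 7 \<or> k mod 7 = (m + 4 - 1) mod 7
        \<or> k mod 7 = (m + 4 - 2) mod 7 \<or> k mod 7 = (m + 4 - 6) mod 7"
      using mod7_diff[OF k(2)] by simp
    then have "k mod 7 = (m + 4) mod 7 \<or> k mod 7 = (m + 3) mod 7 \<or> k mod 7 = (m + 2) mod 7
        \<or> k mod 7 = (m + 5) mod 7"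
      using mod_add_self2[of "m - 2" 7] by (simp add: add.commute)
    then show ?thesis
      using hk has_quad_cong has_quad_has_quad3[OF m] has_quad_has_quad4[OF m] by blast
  qed
  \<comment> \<open>Positions 0 and 3 are not both bridged, so at least one of them yields a
    \<open>quad\<close> vertex.\<close>
  obtain m where m: "has_quad m"
    using wide[of 0] wide[of 3] bridged_bridged3[of 0] by (auto simp: has_quad_def)
  obtain i where i: "has_quad i" "has_quad (i + 2)"
  proof (cases "has_quad (m + 2)")
    case True
    then show ?thesis using that m by blast
  next
    case False
    then show ?thesis
      using that[of "m + 5"] step[OF m] m has_quad_cong[of "m + 7" m] by (simp add: add.assoc)
  qed
  have n1: "\<not> has_quad (i + 1)"
    using step[of "i + 1"] has_quad_has_quad3[OF i(1)] has_quad_has_quad4[OF i(2)]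
    by (auto simp: add.assoc)
  have quads: "k mod 7 = i mod 7 \<or> k mod 7 = (i + 2) mod 7" if k: "has_quad k" for k
  proof -
    have "has_quad (i + (k - i) mod 7)"
      using k has_quad_cong[of "i + (k - i) mod 7" k] by (simp add: mod_add_right_eq)
    then have "(k - i) mod 7 \<notin> {1, 3, 4, 5, 6}"
      using n1 has_quad_has_quad3[OF i(1)] has_quad_has_quad4[OF i(1)]
        has_quad_has_quad3[OF i(2)] has_quad_has_quad4[OF i(2)] by (auto simp: add.assoc)
    then have "(k - i) mod 7 = 0 \<or> (k - i) mod 7 = 2" using mod7_cases[of "k - i"] by blast
    moreover have "k mod 7 = (i + (k - i) mod 7) mod 7" by (simp add: mod_add_right_eq)
    ultimately show ?thesis by auto
  qed
  have in_class: "\<exists>v. (quad i v \<and> (j - i) mod 7 \<in> {0, 1, 2, 6} \<or>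
      quad (i + 2) v \<and> (j - (i + 2)) mod 7 \<in> {0, 1, 2, 6}) \<and> f v = f (h j)"
    if nb: "\<not> bridged j" for j
  proof -
    obtain v k where k: "quad k v" "f v = f (h j)" "(j - k) mod 7 \<in> {0, 1, 2, 6}"
      using wide[OF nb] by metis
    then have "k mod 7 = i mod 7 \<or> k mod 7 = (i + 2) mod 7"
      using quads by (auto simp: has_quad_def)
    then show ?thesis
      using k quad_cong[of k _ v] mod_diff_cong[of j 7 j k] by metis
  qed
  \<comment> \<open>\<open>h (i + 5)\<close> is in neither of the traces belonging to the only
    \<open>quad\<close> positions \<open>i\<close> and \<open>i + 2\<close>.\<close>
  have "bridged (i + 5)" using in_class[of "i + 5"] by auto
  then have nb: "\<not> bridged (i + 1)" "\<not> bridged (i + 2)"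
    using bridged_bridged4[of "i + 1"] bridged_bridged3[of "i + 2"] by (auto simp: add.assoc)
  have nb': "\<not> bridged (i + 4)" "\<not> bridged (i + 6)"
    using has_quad_bridged4[OF i(1)] has_quad_bridged4[OF i(2)] by (auto simp: add.assoc)
  obtain b where b: "quad i b" "f b = f (h (i + 6))" using in_class[OF nb'(2)] by auto
  obtain c where c: "quad (i + 2) c" "f c = f (h (i + 4))" using in_class[OF nb'(1)] by auto
  \<comment> \<open>Both positions hold a single vertex, already used by the classes of
    \<open>h (i + 6)\<close> and \<open>h (i + 4)\<close>, so the class of \<open>h (i + 1)\<close>
    coincides with one of these.\<close>
  obtain v where v: "quad i v \<or> quad (i + 2) v" "f v = f (h (i + 1))" using in_class[OF nb(1)] by auto
  then have "v = b \<or> v = c"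
    using quad_unique_right[OF b(1) _ nb(1)] quad_unique_left[OF c(1) _ nb(2)] by blast
  then have "F (h (i + 1)) (h (i + 6)) \<or> F (h (i + 1)) (h (i + 4))"
    using proper_F[OF f h_in h_in] v b c by metis
  then show False by (simp add: h_F)
qed

end

section \<open>Holes of length six\<close>

locale reduced_hole6 = reflexive_symmetric F for F :: "'a \<Rightarrow> 'a \<Rightarrow> bool" +
  fixes V :: "'a set" and h :: "int \<Rightarrow> 'a"
  assumes thin: "thin V" and hole: "hole V 6 h"
    and no_hole7: "\<not> hole V 7 g"
    and undominated: "\<not> dominates V u v"
begin

lemma h_in [simp]: "h i \<in> V"
  using hole by (simp add: hole_def)

lemma h_mod: "h (i mod 6) = h i"
  using hole by (simp add: hole_def)

lemma h_cong: "i mod 6 = j mod 6 \<Longrightarrow> h i = h j"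
  using h_mod by metis

lemma h_F: "F (h i) (h j) \<longleftrightarrow> (j - i) mod 6 \<in> {0, 1, 5}"
  using hole by (simp add: hole_def)

lemma mod6_cases:
  fixes k :: int
  shows "k mod 6 \<in> {0, 1, 2, 3, 4, 5}"
  by (simp; presburger)

lemma h_shift: "h j = h (i + (j - i) mod 6)"
  by (rule h_cong) (simp add: mod_add_right_eq)

lemma diff_shift: "(j - (i + (k - i) mod 6)) mod 6 = (j - k) mod 6" for i j k :: int
  by (rule mod_diff_cong) (simp_all add: mod_add_right_eq)

text \<open>The same analysis as for a 7-hole; on the shorter cycle an interval has three vertices
  or only two.\<close>

lemma vertex_types:
  assumes x: "x \<in> V"
  shows "(\<forall>i. F x (h i)) \<or> (\<exists>i. \<forall>j. F x (h j) \<longleftrightarrow> (j - i) mod 6 \<in> {0, 1, 5}) \<or>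
    (\<exists>i. \<forall>j. F x (h j) \<longleftrightarrow> (j - i) mod 6 \<in> {0, 1})"
proof -
  have "\<not> (\<forall>i. \<not> F x (h i))"
    using thin_K4[OF thin x, of "h 0" "h 2" "h 4"] by (auto simp: h_F)
  then consider "\<forall>i. F x (h i)" | i where "F x (h i)" "\<not> F x (h (i - 1))"
    using ex_cut_or_all[of "\<lambda>i. F x (h i)" 6] by (auto simp: h_mod)
  then show ?thesis
  proof cases
    case 1
    then show ?thesis by blast
  next
    case 2
    have C4: "F x (h (j + 1))" if "F x (h j)" "F x (h (j + 2))" for j
      using thin_C4[OF thin x, of "h j" "h (j + 1)" "h (j + 2)"] that by (auto simp: h_F F_commute)
    have C5: "F x (h (j + 1)) \<or> F x (h (j + 2))" if "F x (h j)" "F x (h (j + 3))" for j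
      using thin_C5[OF thin x, of "h j" "h (j + 1)" "h (j + 2)" "h (j + 3)"] that
      by (auto simp: h_F F_commute)
    have h6: "h (i + 6) = h i" "h (i + 5) = h (i - 1)"
      using h_cong[OF mod_add_self2, of i] h_cong[OF mod_add_self2, of "i - 1"]
      by (simp_all add: add.commute)
    have n5: "\<not> F x (h (i + 5))" using 2 h6 by simp
    have n4: "\<not> F x (h (i + 4))" using C4[of "i + 4"] 2 n5 h6 by (auto simp: add.commute)
    have n3: "\<not> F x (h (i + 3))" using C5[of "i + 3"] 2 n4 n5 h6 by (auto simp: add.commute)
    have p1: "F x (h (i + 1))"
      using thin_K4[OF thin x, of "h (i + 1)" "h (i + 3)" "h (i + 5)"] n3 n5 by (auto simp: h_F)
    show ?thesis
    proof (cases "F x (h (i + 2))")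
      case True
      have "F x (h j) \<longleftrightarrow> (j - (i + 1)) mod 6 \<in> {0, 1, 5}" for j
      proof -
        have "(j - (i + 1)) mod 6 = ((j - i) mod 6 - 1) mod 6"
          by (simp add: mod_diff_left_eq algebra_simps)
        then show ?thesis
          using mod6_cases[of "j - i"] 2 p1 True n3 n4 n5 h_shift[of j i] by (elim insertE) auto
      qed
      then show ?thesis by blast
    next
      case False
      have "F x (h j) \<longleftrightarrow> (j - i) mod 6 \<in> {0, 1}" for j
        using mod6_cases[of "j - i"] 2 p1 False n3 n4 n5 h_shift[of j i] by (elim insertE) auto
      then show ?thesis by blast
    qed
  qed
qed

lemma private_neighbor:
  assumes "u \<in> V" "v \<in> V" "u \<noteq> v"
  shows "\<exists>w\<in>V. F v w \<and> \<not> F u w"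
  using undominated[of u v] assms by (auto simp: dominates_def)

text \<open>Neighbours \<open>y\<close>, \<open>z\<close> of \<open>x\<close> unrelated to
  \<open>h i\<close> and \<open>h (i + 1)\<close> respectively must have traces centred at
  \<open>i + 2\<close> and \<open>i + 5\<close>. Then \<open>x\<close>, \<open>y\<close>,
  \<open>h (i + 3)\<close>, \<open>h (i + 4)\<close>, \<open>z\<close> is an induced
  5-cycle.\<close>

lemma not_two_consecutive:
  assumes x: "x \<in> V"
  shows "\<not> (\<forall>j. F x (h j) \<longleftrightarrow> (j - i) mod 6 \<in> {0, 1})"
proof
  assume "\<forall>j. F x (h j) \<longleftrightarrow> (j - i) mod 6 \<in> {0, 1}"
  then have xF: "F x (h j) \<longleftrightarrow> (j - i) mod 6 \<in> {0, 1}"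
    and xF': "F (h j) x \<longleftrightarrow> (j - i) mod 6 \<in> {0, 1}" for j
    using F_commute[of x "h j"] by auto
  have side: "\<exists>d \<in> {2, 5}. \<forall>j. F y (h j) \<longleftrightarrow> (j - (i + d)) mod 6 \<in> {0, 1, 5}"
    if y: "y \<in> V" "F x y" "\<not> F (h e) y" and e: "e \<in> {i, i + 1}" for y e
  proof -
    have "\<not> F y (h e)" using y F_sym by blast
    then have "(\<exists>k. \<forall>j. F y (h j) \<longleftrightarrow> (j - k) mod 6 \<in> {0, 1, 5}) \<or>
        (\<exists>k. \<forall>j. F y (h j) \<longleftrightarrow> (j - k) mod 6 \<in> {0, 1})"
      using vertex_types[OF y(1)] by metis
    then show ?thesis
    proof (elim disjE exE)
      fix k
      assume k: "\<forall>j. F y (h j) \<longleftrightarrow> (j - k) mod 6 \<in> {0, 1, 5}"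
      define d where "d = (k - i) mod 6"
      have yF: "F y (h j) \<longleftrightarrow> (j - (i + d)) mod 6 \<in> {0, 1, 5}" for j
        using k diff_shift[of j i k] by (simp add: d_def)
      have "d \<noteq> 3"
        using thin_C4[OF thin x y(1), of "h (i + 2)" "h (i + 1)"] y(2)
        by (auto simp: xF xF' yF h_F)
      moreover have "d \<noteq> 4"
        using thin_C4[OF thin x y(1), of "h (i + 5)" "h i"] y(2)
        by (auto simp: xF xF' yF h_F)
      moreover have "d \<noteq> 0" "d \<noteq> 1"
        using \<open>\<not> F y (h e)\<close> e by (auto simp: yF)
      ultimately have "d \<in> {2, 5}"
        using mod6_cases[of "k - i"] unfolding d_def[symmetric] by auto
      then show ?thesis using yF by blast
    next
      fix k
      assume k: "\<forall>j. F y (h j) \<longleftrightarrow> (j - k) mod 6 \<in> {0, 1}"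
      define d where "d = (k - i) mod 6"
      have yF: "F y (h j) \<longleftrightarrow> (j - (i + d)) mod 6 \<in> {0, 1}" for j
        using k diff_shift[of j i k] by (simp add: d_def)
      have yF': "F (h j) y \<longleftrightarrow> (j - (i + d)) mod 6 \<in> {0, 1}" for j
        using yF[of j] by (simp add: F_commute[of "h j" y])
      have yx: "F y x" using y F_sym by blast
      \<comment> \<open>If the two-vertex traces of \<open>x\<close> and \<open>y\<close> overlap in
        one vertex, replacing that vertex by \<open>x\<close> and \<open>y\<close> gives a
        7-hole.\<close>
      have "d \<noteq> 1"
        using hole7I[of x y "h (i + 2)" "h (i + 3)" "h (i + 4)" "h (i + 5)" "h i" V] no_hole7 x y
        by (auto simp: xF xF' yF h_F)
      moreover have "d \<noteq> 5"
        using hole7I[of y x "h (i + 1)" "h (i + 2)" "h (i + 3)" "h (i + 4)" "h (i + 5)" V]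
          no_hole7 x y yx by (auto simp: xF yF yF' h_F)
      moreover have "d \<noteq> 2"
        using thin_C4[OF thin x y(1), of "h (i + 2)" "h (i + 1)"] y(2)
        by (auto simp: xF xF' yF h_F)
      moreover have "d \<noteq> 3"
        using thin_C5[OF thin x y(1), of "h (i + 3)" "h (i + 2)" "h (i + 1)"] y(2)
        by (auto simp: xF xF' yF h_F)
      moreover have "d \<noteq> 4"
        using thin_C4[OF thin x y(1), of "h (i + 5)" "h i"] y(2)
        by (auto simp: xF xF' yF h_F)
      moreover have "d \<noteq> 0"
        using \<open>\<not> F y (h e)\<close> e by (auto simp: yF)
      ultimately show ?thesis
        using mod6_cases[of "k - i"] unfolding d_def[symmetric] by auto
    qed
  qed
  have "x \<noteq> h i" "x \<noteq> h (i + 1)"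
    using xF[of "i + 5"] xF[of "i + 2"] h_F[of i "i + 5"] h_F[of "i + 1" "i + 2"] by auto
  then obtain y z where y: "y \<in> V" "F x y" "\<not> F (h i) y"
    and z: "z \<in> V" "F x z" "\<not> F (h (i + 1)) z"
    using private_neighbor[OF h_in x] by metis
  obtain d where "d \<in> {2, 5}" and d: "\<And>j. F y (h j) \<longleftrightarrow> (j - (i + d)) mod 6 \<in> {0, 1, 5}"
    using side[OF y] by auto
  moreover have "d \<noteq> 5" using d[of i] y(3) by (auto simp: F_commute[of y])
  ultimately have yF: "F y (h j) \<longleftrightarrow> (j - (i + 2)) mod 6 \<in> {0, 1, 5}" for j by auto
  obtain e where "e \<in> {2, 5}" and e: "\<And>j. F z (h j) \<longleftrightarrow> (j - (i + e)) mod 6 \<in> {0, 1, 5}"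
    using side[OF z] by auto
  moreover have "e \<noteq> 2" using e[of "i + 1"] z(3) by (auto simp: F_commute[of z])
  ultimately have zF: "F z (h j) \<longleftrightarrow> (j - (i + 5)) mod 6 \<in> {0, 1, 5}" for j by auto
  have yF': "F (h j) y \<longleftrightarrow> (j - (i + 2)) mod 6 \<in> {0, 1, 5}"
    and zF': "F (h j) z \<longleftrightarrow> (j - (i + 5)) mod 6 \<in> {0, 1, 5}" for j
    using yF[of j] zF[of j] by (simp_all add: F_commute[of "h j"])
  have "\<not> F y z"
    using thin_C4[OF thin y(1) z(1), of "h (i + 4)" "h (i + 3)"]
    by (auto simp: yF yF' zF zF' h_F)
  then show False
    using thin_C5[OF thin x y(1), of "h (i + 3)" "h (i + 4)" z] y(2) z F_sym[OF z(2)]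
    by (simp add: xF xF' yF yF' zF zF' h_F)
qed

lemma vertex_type:
  assumes x: "x \<in> V"
  shows "\<exists>i. \<forall>j. F x (h j) \<longleftrightarrow> (j - i) mod 6 \<in> {0, 1, 5}"
proof -
  have "\<not> (\<forall>i. F x (h i))"
  proof
    assume all: "\<forall>i. F x (h i)"
    have x0: "x \<noteq> h 0" using all h_F[of 0 2] by auto
    obtain w where w: "w \<in> V" "\<not> F x w" using private_neighbor[OF x h_in x0] by blast
    have C4: "False" if "\<not> F (h j) (h k)" "F w (h j)" "F w (h k)" for j k
      using thin_C4[OF thin x h_in w(1) h_in, of j k] all w(2) that by (auto simp: F_commute)
    from vertex_types[OF w(1)] show False
    proof (elim disjE exE)
      assume "\<forall>i. F w (h i)"
      then show False using C4[of 0 2] by (auto simp: h_F)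
    next
      fix i
      assume "\<forall>j. F w (h j) \<longleftrightarrow> (j - i) mod 6 \<in> {0, 1, 5}"
      then show False using C4[of "i - 1" "i + 1"] by (simp add: h_F)
    next
      fix i
      assume "\<forall>j. F w (h j) \<longleftrightarrow> (j - i) mod 6 \<in> {0, 1}"
      then show False using not_two_consecutive[OF w(1)] by metis
    qed
  qed
  then show ?thesis using vertex_types[OF x] not_two_consecutive[OF x] by metis
qed

text \<open>A vertex \<open>x\<close> with the trace of \<open>h i\<close> but distinct from it
  would have a neighbour unrelated to \<open>h i\<close>. Its trace is centred at distance 2 or 3
  from \<open>i\<close>, which closes an induced cycle of length 5 or 4.\<close>

lemma vertices: "V = range h"
proof (intro equalityI subsetI)
  fix x
  assume x: "x \<in> V"
  obtain i where i: "\<And>j. F x (h j) \<longleftrightarrow> (j - i) mod 6 \<in> {0, 1, 5}"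
    using vertex_type[OF x] by blast
  have i': "F (h j) x \<longleftrightarrow> (j - i) mod 6 \<in> {0, 1, 5}" for j
    using i[of j] by (simp add: F_commute[of "h j" x])
  have "x = h i"
  proof (rule ccontr)
    assume "x \<noteq> h i"
    then obtain y where y: "y \<in> V" "F x y" "\<not> F (h i) y"
      using private_neighbor[of "h i" x] x by auto
    obtain k where k: "\<And>j. F y (h j) \<longleftrightarrow> (j - k) mod 6 \<in> {0, 1, 5}"
      using vertex_type[OF y(1)] by blast
    define d where "d = (k - i) mod 6"
    have kd: "F y (h j) \<longleftrightarrow> (j - (i + d)) mod 6 \<in> {0, 1, 5}" for j
      using k diff_shift[of j i k] by (simp add: d_def)
    have "(i - (i + d)) mod 6 \<notin> {0, 1, 5}" using kd[of i] y(3) by (simp add: F_commute[of y "h i"])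
    then have "d \<in> {2, 3, 4}"
      using mod6_cases[of "k - i"] unfolding d_def[symmetric] by auto
    then consider "d = 2" | "d = 3" | "d = 4" by blast
    then show False
    proof cases
      case 1
      then show False
        using thin_C5[OF thin x y(1), of "h (i + 3)" "h (i + 4)" "h (i + 5)"] y
        by (simp add: i i' kd h_F)
    next
      case 2
      then show False
        using thin_C4[OF thin x y(1), of "h (i + 2)" "h (i + 1)"] y by (simp add: i i' kd h_F)
    next
      case 3
      then show False
        using thin_C5[OF thin x y(1), of "h (i + 3)" "h (i + 2)" "h (i + 1)"] y
        by (simp add: i i' kd h_F)
    qed
  qed
  then show "x \<in> range h" by blast
qed auto

lemma vertices_list: "V \<subseteq> {h i, h (i + 1), h (i + 2), h (i + 3), h (i + 4), h (i + 5)}"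
proof
  fix x
  assume "x \<in> V"
  then obtain j where j: "x = h j" using vertices by blast
  show "x \<in> {h i, h (i + 1), h (i + 2), h (i + 3), h (i + 4), h (i + 5)}"
    using mod6_cases[of "j - i"] h_shift[of j i] unfolding j by (elim insertE) auto
qed

definition S :: "int \<Rightarrow> 'a set" where
  "S i = {h i, h (i + 1)}"

lemma S_subset: "S i \<subseteq> V"
  by (simp add: S_def)

lemma S_clique: "clique (S i)"
  by (auto simp: S_def clique_def h_F)

lemma colorable_outside: "colorable (V - S i) 2"
proof -
  have F: "F (h (i + 2)) (h (i + 3))" "F (h (i + 3)) (h (i + 2))"
    "F (h (i + 4)) (h (i + 5))" "F (h (i + 5)) (h (i + 4))"
    by (simp_all add: h_F)
  have "proper (V - S i) {..<2} (\<lambda>v. if v \<in> {h (i + 2), h (i + 3)} then 0 else 1)"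
    by (rule properI) (use vertices_list[of i] F in \<open>auto simp: S_def split: if_splits\<close>)
  then show ?thesis unfolding colorable_def by blast
qed

lemma colorable3: "colorable V 3"
proof -
  have F: "F (h 0) (h 1)" "F (h 1) (h 0)" "F (h 2) (h 3)" "F (h 3) (h 2)" "F (h 4) (h 5)"
    "F (h 5) (h 4)"
    by (simp_all add: h_F)
  have "proper V {..<3} (\<lambda>v. if v \<in> {h 0, h 1} then 0 else if v \<in> {h 2, h 3} then 1 else 2)"
    by (rule properI) (use vertices_list[of 0] F in \<open>auto split: if_splits\<close>)
  then show ?thesis unfolding colorable_def by blast
qed

lemma S_disjoint: "S i \<inter> S (i + 2) = {}" "S i \<inter> S (i + 3) = {}"
proof -
  have neq: "h a \<noteq> h b" if "(b - a) mod 6 \<in> {2, 3, 4}" for a b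
    using h_F[of a b] that by auto
  have "h (i + 1) \<noteq> h (i + 2)"
    using h_F[of i "i + 1"] h_F[of i "i + 2"] by auto
  then show "S i \<inter> S (i + 2) = {}" "S i \<inter> S (i + 3) = {}"
    using neq[of "i + 2" i] neq[of "i + 3" i] neq[of "i + 4" i] neq[of "i + 3" "i + 1"]
      neq[of "i + 4" "i + 1"] by (auto simp: S_def add.assoc)
qed

lemma S_cong: "i mod 6 = j mod 6 \<Longrightarrow> S i = S j"
  using h_cong[of i j] h_cong[of "i + 1" "j + 1"] by (simp add: S_def mod_add_cong)

lemma S_linked:
  "(\<lambda>T U. T \<in> range S \<and> U \<in> range S \<and> T \<inter> U = {})\<^sup>*\<^sup>* (S i) (S j)"
proof -
  let ?R = "\<lambda>T U. T \<in> range S \<and> U \<in> range S \<and> T \<inter> U = {}"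
  have three_steps: "R\<^sup>*\<^sup>* a d" if "R a b" "R b c" "R c d" for R and a b c d :: "'a set"
    using that by (meson converse_rtranclp_into_rtranclp r_into_rtranclp)
  \<comment> \<open>Steps of length 2 preserve parity modulo 6, so one step of length 3 is included:
    3 + 2 + 2 is 1 modulo 6.\<close>
  have succ: "?R\<^sup>*\<^sup>* (S i) (S (i + 1))" for i
  proof -
    have "?R (S i) (S (i + 3))" "?R (S (i + 3)) (S (i + 5))" "?R (S (i + 5)) (S (i + 7))"
      using S_disjoint(2)[of i] S_disjoint(1)[of "i + 3"] S_disjoint(1)[of "i + 5"]
      by (auto simp: add.assoc)
    moreover have "S (i + 7) = S (i + 1)"
      using S_cong[OF mod_add_self2, of "i + 1"] by (simp add: add.commute)
    ultimately show ?thesis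
      by (intro three_steps[of ?R "S i" "S (i + 3)" "S (i + 5)" "S (i + 1)"]) simp_all
  qed
  have "?R\<^sup>*\<^sup>* (S i) (S (i + int k))" for k
  proof (induction k)
    case 0 then show ?case by simp
  next
    case (Suc k)
    show ?case
      using rtranclp_trans[OF Suc succ[of "i + int k"]] by (simp add: algebra_simps)
  qed
  from this[of "nat ((j - i) mod 6)"]
  have "?R\<^sup>*\<^sup>* (S i) (S (i + (j - i) mod 6))" by simp
  moreover have "S (i + (j - i) mod 6) = S j"
    by (rule S_cong) (simp add: mod_add_right_eq)
  ultimately show ?thesis by simp
qed

lemma class_within_S:
  assumes f: "proper V C f"
  shows "\<exists>i. \<forall>v\<in>V. f v = f (h 0) \<longrightarrow> v \<in> S i"
proof -
  have nF: "\<not> F (h 0) (h 2)" "\<not> F (h 0) (h 3)" "\<not> F (h 0) (h 4)" "\<not> F (h 1) (h 5)"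
    by (simp_all add: h_F)
  then have ne: "f (h 2) \<noteq> f (h 0)" "f (h 3) \<noteq> f (h 0)" "f (h 4) \<noteq> f (h 0)"
    "f (h 1) = f (h 0) \<Longrightarrow> f (h 5) \<noteq> f (h 0)"
    using proper_F[OF f h_in h_in] by metis+
  have h60: "h 6 = h 0" by (rule h_cong) simp
  show ?thesis
  proof (cases "f (h 1) = f (h 0)")
    case True
    then have "\<forall>v\<in>V. f v = f (h 0) \<longrightarrow> v \<in> S 0"
      using vertices_list[of 0] ne by (auto simp: S_def)
    then show ?thesis by blast
  next
    case False
    then have "\<forall>v\<in>V. f v = f (h 0) \<longrightarrow> v \<in> S 5"
      using vertices_list[of 0] ne h60 by (auto simp: S_def)
    then show ?thesis by blast
  qed
qed

end

section \<open>Induction on the number of vertices\<close>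

context reflexive_symmetric
begin

section \<open>Independent sets and the number of colours\<close>

definition independent :: "'a set \<Rightarrow> bool" where
  "independent T \<longleftrightarrow> (\<forall>x\<in>T. \<forall>y\<in>T. x \<noteq> y \<longrightarrow> \<not> F x y)"

lemma thin_independent:
  assumes thin: "thin V" and T: "T \<subseteq> V" "independent T"
  shows "card T \<le> 3"
proof (rule ccontr)
  assume "\<not> card T \<le> 3"
  then obtain U where U: "U \<subseteq> T" "card U = 4"
    using obtain_subset_with_card_n[of 4 T] by auto
  then obtain a b c d where "U = {a, b, c, d}" "distinct [a, b, c, d]"
    by (auto simp: card_Suc_eq numeral_eq_Suc)
  then show False
    using thin_K4[OF thin, of a b c d] T U unfolding independent_def by auto
qed

text \<open>Deleting a dominating vertex keeps the bound, and deleting an isolated vertex of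
  \<open>F\<close> lowers both numbers by one. Otherwise \<open>F\<close> is a 6-cycle, where both
  are 3. With \<open>k = 3\<close> this colours what remains after removing a clique that meets all
  7-holes.\<close>

lemma colorable_independence_number:
  assumes "finite V" "thin V" "\<And>h. \<not> hole V 7 h"
    and "\<And>T. T \<subseteq> V \<Longrightarrow> independent T \<Longrightarrow> card T \<le> k"
  shows "colorable V k"
  using assms
proof (induction V arbitrary: k rule: finite_psubset_induct)
  case (psubset V)
  have IH: "colorable (V - {v}) m"
    if "v \<in> V" "\<And>T. T \<subseteq> V - {v} \<Longrightarrow> independent T \<Longrightarrow> card T \<le> m" for v m
    using psubset.IH[of "V - {v}" m] that psubset.prems(1,2) thin_mono[of V "V - {v}"]
      hole_mono[of "V - {v}" 7 _ V] by blast
  consider "V = {}" | u v where "dominates V u v"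
    | v where "v \<in> V" "\<And>w. w \<in> V \<Longrightarrow> F v w \<Longrightarrow> w = v"
    | "V \<noteq> {}" "\<And>u v. \<not> dominates V u v" "\<And>v. v \<in> V \<Longrightarrow> \<exists>w\<in>V. w \<noteq> v \<and> F v w"
    by blast
  then show ?case
  proof cases
    case 1
    then show ?thesis by (auto simp: colorable_def proper_def)
  next
    case (2 u v)
    then have "colorable (V - {u}) k"
      using IH[of u k] psubset.prems(3) unfolding dominates_def by blast
    then show ?thesis using colorable_dominates 2 by blast
  next
    case (3 v)
    have k: "k \<ge> 1"
      using psubset.prems(3)[of "{v}"] 3(1) by (simp add: independent_def)
    have "card T \<le> k - 1" if T: "T \<subseteq> V - {v}" "independent T" for T
    proof -
      have "independent (insert v T)"
        using T 3 F_sym unfolding independent_def by (metis DiffD1 insertE subsetD)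
      then have "card (insert v T) \<le> k" using psubset.prems(3)[of "insert v T"] T 3(1) by blast
      moreover have "finite T" "v \<notin> T"
        using T psubset.hyps finite_subset[of T V] by auto
      ultimately show ?thesis by auto
    qed
    then obtain f where f: "proper (V - {v}) {..<k - 1} f"
      using IH[of v "k - 1"] 3(1) unfolding colorable_def by blast
    have lt: "f u < k - 1" if "u \<in> V" "u \<noteq> v" for u
      using proper_in[OF f, of u] that by auto
    have "proper V {..<k} (f(v := k - 1))"
    proof (rule properI)
      show "(f(v := k - 1)) u \<in> {..<k}" if "u \<in> V" for u
        using lt[of u] k that by auto
      show "F u w" if "u \<in> V" "w \<in> V" "u \<noteq> w" "(f(v := k - 1)) u = (f(v := k - 1)) w" for u w
        using that lt[of u] lt[of w] proper_F[OF f, of u w] by (auto split: if_splits)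
    qed
    then show ?thesis unfolding colorable_def by blast
  next
    case 4
    then obtain h where h: "hole V 6 h"
      using ex_hole[OF psubset.prems(1)] psubset.prems(2) by blast
    interpret r: reduced_hole6 F V h
      by unfold_locales (use psubset.prems h 4 in auto)
    have nF: "\<not> F (h 0) (h 2)" "\<not> F (h 0) (h 4)" "\<not> F (h 2) (h 4)"
      by (simp_all add: r.h_F)
    then have "independent {h 0, h 2, h 4}"
      by (auto simp: independent_def F_commute)
    moreover have "card {h 0, h 2, h 4} = 3"
    proof -
      have "h 0 \<noteq> h 2" "h 0 \<noteq> h 4" "h 2 \<noteq> h 4" using nF by (metis F_refl)+
      then show ?thesis by simp
    qed
    ultimately have "3 \<le> k" using psubset.prems(3)[of "{h 0, h 2, h 4}"] by simp
    then show ?thesis using colorable_mono[OF r.colorable3] by blast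
  qed
qed

lemma hole6_colorable:
  assumes "hole V 6 h" "colorable V n"
  shows "n \<ge> 3"
proof -
  obtain f where f: "proper V {..<n} f" using assms(2) by (auto simp: colorable_def)
  have h: "h i \<in> V" for i using assms(1) by (simp add: hole_def)
  have "\<not> F (h 0) (h 2)" "\<not> F (h 0) (h 4)" "\<not> F (h 2) (h 4)"
    using assms(1) by (simp_all add: hole_def)
  then have "f (h 0) \<noteq> f (h 2)" "f (h 0) \<noteq> f (h 4)" "f (h 2) \<noteq> f (h 4)"
    using proper_F[OF f h h] by metis+
  moreover have "f (h 0) < n" "f (h 2) < n" "f (h 4) < n"
    using proper_in[OF f h] by auto
  ultimately show ?thesis by linarith
qed

text \<open>With three colours, two vertices that are both unrelated to the same unrelated pair must
  share the third colour. This makes \<open>h 4\<close>, \<open>h 5\<close> and \<open>h 6\<close>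
  equal in colour, although \<open>h 4\<close> and \<open>h 6\<close> are unrelated.\<close>

lemma hole7_colorable:
  assumes "hole V 7 h" "colorable V n"
  shows "n \<ge> 4"
proof (rule ccontr)
  assume "\<not> n \<ge> 4"
  obtain f where f: "proper V {..<n} f" using assms(2) by (auto simp: colorable_def)
  have h: "h i \<in> V" for i using assms(1) by (simp add: hole_def)
  have lt: "f (h i) < 3" for i
    using proper_in[OF f h, of i] \<open>\<not> n \<ge> 4\<close> by auto
  have ne: "f (h i) \<noteq> f (h j)" if "(j - i) mod 7 \<in> {2, 3, 4, 5}" for i j
    using proper_F[OF f h h, of i j] that assms(1) by (auto simp: hole_def)
  have third: "f (h l) = f (h k)"
    if "(j - i) mod 7 \<in> {2, 3, 4, 5}" "(k - i) mod 7 \<in> {2, 3, 4, 5}"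
      "(k - j) mod 7 \<in> {2, 3, 4, 5}" "(l - i) mod 7 \<in> {2, 3, 4, 5}"
      "(l - j) mod 7 \<in> {2, 3, 4, 5}" for i j k l
    using ne[OF that(1)] ne[OF that(2)] ne[OF that(3)] ne[OF that(4)] ne[OF that(5)]
      lt[of i] lt[of j] lt[of k] lt[of l] by linarith
  have "f (h 5) = f (h 4)" by (rule third[of 2 0]) auto
  moreover have "f (h 6) = f (h 5)" by (rule third[of 3 1]) auto
  ultimately show False using ne[of 6 4] by simp
qed

text \<open>Colourability with \<open>card C - 1\<close> colours expresses that there are more
  colours than the chromatic number. The colour set is arbitrary so that the induction can drop the
  colour of a fixed class.\<close>

theorem thin_mixing:
  assumes "finite V" "thin V" "finite C" "C \<noteq> {}" "colorable V (card C - 1)"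
  shows "mixing V C"
  using assms
proof (induction V arbitrary: C rule: finite_psubset_induct)
  case (psubset V)
  have thin: "thin V" using psubset.prems by blast
  have IH: "mixing W D"
    if "W \<subset> V" "finite D" "D \<noteq> {}" "colorable W (card D - 1)" for W D
    using psubset.IH[OF that(1) _ that(2-4)] thin_mono[OF thin] that(1) by blast
  have IH': "mixing (V - T) (C - {c})"
    if T: "T \<subseteq> V" "T \<noteq> {}" and c: "c \<in> C" "card C \<ge> 2" and col: "colorable (V - T) (card C - 2)"
    for T c
  proof (rule IH)
    show "V - T \<subset> V" using T by blast
    show "finite (C - {c})" using psubset.prems by blast
    have "card (C - {c}) = card C - 1" using c psubset.prems by simp
    then have "card (C - {c}) \<noteq> 0" using c by linarith
    then show "C - {c} \<noteq> {}" by force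
    show "colorable (V - T) (card (C - {c}) - 1)"
      using \<open>card (C - {c}) = card C - 1\<close> col by (simp add: numeral_2_eq_2)
  qed
  consider "V = {}" | u v where "dominates V u v"
    | v where "v \<in> V" "\<And>w. w \<in> V \<Longrightarrow> F v w \<Longrightarrow> w = v"
    | "V \<noteq> {}" "\<And>u v. \<not> dominates V u v" "\<And>v. v \<in> V \<Longrightarrow> \<exists>w\<in>V. w \<noteq> v \<and> F v w"
    by blast
  then show ?case
  proof cases
    case 1
    then show ?thesis by (auto simp: mixing_def recolor_step_def)
  next
    case (2 u v)
    then have u: "u \<in> V" by (simp add: dominates_def)
    have "mixing (V - {u}) C"
      by (rule IH) (use u psubset.prems colorable_mono in blast)+
    then show ?thesis using mixing_dominates 2 by blast
  next
    case (3 v)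
    obtain f where f: "proper V {..<card C - 1} f"
      using psubset.prems(4) by (auto simp: colorable_def)
    \<comment> \<open>This also shows that \<open>C\<close> has at least two colours. As
      \<open>v\<close> is alone in its class, deleting it frees its colour as well.\<close>
    have fv: "f v < card C - 1" using proper_in[OF f 3(1)] by simp
    have "proper (V - {v}) ({..<card C - 1} - {f v}) f"
    proof (rule properI)
      show "f u \<in> {..<card C - 1} - {f v}" if "u \<in> V - {v}" for u
        using proper_in[OF f, of u] proper_F[OF f, of v u] 3 that by auto
    qed (use proper_F[OF f] in blast)
    then have col: "colorable (V - {v}) (card C - 2)"
      by (rule colorableI) (use fv in auto)
    show ?thesis
    proof (rule mixing_family[where \<S> = "{{v}}"])
      show "\<exists>c\<in>C. \<exists>S\<in>{{v}}. \<forall>u\<in>V. g u = c \<longrightarrow> u \<in> S" if g: "proper V C g" for g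
        using proper_in[OF g 3(1)] proper_F[OF g 3(1)] 3(2) by auto metis
      show "mixing (V - S) (C - {c})" if "S \<in> {{v}}" "c \<in> C" for S c
        using IH'[of "{v}" c] that col 3(1) fv by auto
    qed (use psubset.hyps psubset.prems fv col 3(1) in \<open>auto simp: clique_def\<close>)
  next
    case 4
    show ?thesis
    proof (cases "\<exists>h. hole V 7 h")
      case True
      then obtain h where h: "hole V 7 h" by blast
      interpret r: reduced_hole7 F V h
        by unfold_locales (use thin h 4 in auto)
      have C: "card C \<ge> 5" using hole7_colorable[OF h psubset.prems(4)] by linarith
      \<comment> \<open>Without 7-holes and without four independent vertices, three colours
        suffice, and \<open>card C \<ge> 5\<close> leaves two spare ones.\<close>
      have col3: "colorable (V - r.S i) 3" for i
        by (rule colorable_independence_number)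
          (use psubset.hyps thin_mono[OF thin, of "V - r.S i"] r.no_hole_outside
            thin_independent[of "V - r.S i"] in auto)
      have col: "colorable (V - r.S i) (card C - 2)" for i
        using C colorable_mono[OF col3[of i] subset_refl] by simp
      have ne: "r.S i \<noteq> {}" for i using r.tri_h by (auto simp: r.S_def)
      show ?thesis
      proof (rule mixing_family[where \<S> = "range r.S"])
        show "\<exists>c\<in>C. \<exists>S\<in>range r.S. \<forall>u\<in>V. g u = c \<longrightarrow> u \<in> S" if g: "proper V C g" for g
        proof -
          obtain i j where "\<forall>v\<in>V. g v = g (h j) \<longrightarrow> v \<in> r.S i" using r.class_within_S[OF g] by blast
          then show ?thesis using proper_in[OF g r.h_in, of j] by blast
        qed
        show "mixing (V - S) (C - {c})" if "S \<in> range r.S" "c \<in> C" for S c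
          using IH'[of S c] that col r.S_subset ne C by auto
      qed (use psubset.hyps psubset.prems C col r.S_clique r.S_subset r.S_linked in auto)
    next
      case False
      then obtain h where h: "hole V 6 h" using ex_hole[OF thin] 4 by blast
      interpret r: reduced_hole6 F V h
        by unfold_locales (use thin h 4 False in auto)
      have C: "card C \<ge> 4" using hole6_colorable[OF h psubset.prems(4)] by linarith
      have col: "colorable (V - r.S i) (card C - 2)" for i
        using C colorable_mono[OF r.colorable_outside[of i] subset_refl] by simp
      show ?thesis
      proof (rule mixing_family[where \<S> = "range r.S"])
        show "\<exists>c\<in>C. \<exists>S\<in>range r.S. \<forall>u\<in>V. g u = c \<longrightarrow> u \<in> S" if g: "proper V C g" for g
          using r.class_within_S[OF g] proper_in[OF g r.h_in, of 0] by blast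
        show "mixing (V - S) (C - {c})" if "S \<in> range r.S" "c \<in> C" for S c
          using IH'[of S c] that col r.S_subset C by (auto simp: r.S_def)
      qed (use psubset.hyps psubset.prems C col r.S_clique r.S_subset r.S_linked in auto)
    qed
  qed
qed

end

section \<open>Forbidden induced subgraphs and reconfiguration graphs\<close>

text \<open>The isomorphism sends each vertex of \<open>xs\<close> to its position in the
  list.\<close>

lemma ex_induced_copy:
  assumes G: "pair_graph G" and K: "pverts K = {..<n}" "parcs K \<subseteq> {..<n} \<times> {..<n}"
    and xs: "distinct xs" "length xs = n" "set xs \<subseteq> pverts G"
    and arcs: "\<And>i j. i < n \<Longrightarrow> j < n \<Longrightarrow> (xs ! i, xs ! j) \<in> parcs G \<longleftrightarrow> (i, j) \<in> parcs K"
  shows "\<exists>H. induced_subgraph H (with_proj G) \<and> digraph_iso H (with_proj K)"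
proof -
  interpret pair_graph G by fact
  define W where "W = set xs"
  define H where "H = with_proj \<lparr>pverts = W, parcs = {(a, b) \<in> parcs G. a \<in> W \<and> b \<in> W}\<rparr>"
  define p where "p = the_inv_into {..<n} ((!) xs)"
  have inj: "inj_on ((!) xs) {..<n}"
    using xs by (auto simp: inj_on_def nth_eq_iff_index_eq)
  have W: "W = (!) xs ` {..<n}"
    using xs by (auto simp: W_def in_set_conv_nth)
  have p: "p (xs ! i) = i" if "i < n" for i
    using the_inv_into_f_f[OF inj] that by (simp add: p_def)
  have inj_p: "inj_on p W"
    unfolding p_def W by (rule inj_on_the_inv_into[OF inj])
  have wf: "wf_digraph H"
    by unfold_locales (auto simp: H_def)
  have "subgraph H (with_proj G)"
    unfolding subgraph_def
    using xs wf by (auto simp: H_def W_def compatible_def wf_digraph_def)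
  then have sub: "induced_subgraph H (with_proj G)"
    unfolding induced_subgraph_def by (auto simp: H_def)
  define f where "f = \<lparr>iso_verts = p, iso_arcs = map_prod p p, iso_head = snd, iso_tail = fst\<rparr>"
  have "pre_digraph.digraph_isomorphism H f"
    unfolding pre_digraph.digraph_isomorphism_def
  proof (intro conjI)
    show "inj_on (iso_arcs f) (arcs H)"
      using inj_p by (auto simp: f_def H_def inj_on_def)
  qed (use wf inj_p in \<open>auto simp: f_def H_def\<close>)
  moreover have "with_proj K = app_iso f H"
  proof -
    have "p ` W = {..<n}"
      by (force simp: W p image_iff)
    moreover have "map_prod p p ` {(a, b) \<in> parcs G. a \<in> W \<and> b \<in> W} = parcs K"
    proof (intro equalityI subsetI)
      fix e
      assume "e \<in> map_prod p p ` {(a, b) \<in> parcs G. a \<in> W \<and> b \<in> W}"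
      then obtain i j where "i < n" "j < n" "(xs ! i, xs ! j) \<in> parcs G" "e = (p (xs ! i), p (xs ! j))"
        by (auto simp: W)
      then show "e \<in> parcs K" using arcs p by simp
    next
      fix e
      assume e: "e \<in> parcs K"
      then obtain i j where ij: "e = (i, j)" "i < n" "j < n" using K by auto
      then have "(xs ! i, xs ! j) \<in> {(a, b) \<in> parcs G. a \<in> W \<and> b \<in> W}"
        using arcs e by (auto simp: W)
      moreover have "e = map_prod p p (xs ! i, xs ! j)" using ij p by simp
      ultimately show "e \<in> map_prod p p ` {(a, b) \<in> parcs G. a \<in> W \<and> b \<in> W}" by blast
    qed
    ultimately show ?thesis
      by (simp add: app_iso_def f_def H_def with_proj_def K(1))
  qed
  ultimately show ?thesis using sub unfolding digraph_iso_def by blast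
qed

lemma (in pair_graph) reflexive_symmetric_nonadjacent:
  "reflexive_symmetric (\<lambda>u v. (u, v) \<notin> parcs G)"
  using arcs_symmetric no_loops' by unfold_locales auto

lemma thin_induced_free:
  assumes G: "pair_graph G"
    and free: "induced_free [two_K2, complete_graph 4, cycle_graph 5] G"
  shows "reflexive_symmetric.thin (\<lambda>u v. (u, v) \<notin> parcs G) (pverts G)"
proof -
  interpret pair_graph G by fact
  interpret reflexive_symmetric "\<lambda>u v. (u, v) \<notin> parcs G"
    by (rule reflexive_symmetric_nonadjacent)
  have arc_commute: "(u, v) \<in> parcs G \<longleftrightarrow> (v, u) \<in> parcs G" for u v
    using arcs_symmetric by blast
  have loop: "(u, u) \<notin> parcs G" for u by (rule F_refl)
  have no_copy: "\<not> (\<exists>H. induced_subgraph H (with_proj G) \<and> digraph_iso H (with_proj K))"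
    if "K \<in> {two_K2, complete_graph 4, cycle_graph 5}" for K
    using free that unfolding induced_free_def by (simp del: not_ex) blast
  have small: "{..<4::nat} = {0, 1, 2, 3}" "{..<5::nat} = {0, 1, 2, 3, 4}" by auto
  show ?thesis
    unfolding thin_def
  proof (intro conjI allI impI; rule ccontr)
    fix a b c d
    assume V: "{a, b, c, d} \<subseteq> pverts G"
      and n: "(a, b) \<notin> parcs G \<and> (b, c) \<notin> parcs G \<and> (c, d) \<notin> parcs G \<and> (d, a) \<notin> parcs G"
      and e: "\<not> ((a, c) \<notin> parcs G \<or> (b, d) \<notin> parcs G)"
    have n': "(b, a) \<notin> parcs G" "(c, b) \<notin> parcs G" "(d, c) \<notin> parcs G" "(a, d) \<notin> parcs G"
      "(c, a) \<in> parcs G" "(d, b) \<in> parcs G"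
      using n e arc_commute by blast+
    \<comment> \<open>The diagonals of the 4-cycle of non-edges are the two edges, so the list puts
      the ends of each diagonal next to each other.\<close>
    have "\<exists>H. induced_subgraph H (with_proj G) \<and> digraph_iso H (with_proj two_K2)"
    proof (rule ex_induced_copy[OF G, where xs = "[a, c, b, d]" and n = 4])
      show "distinct [a, c, b, d]" using n e n' loop by auto
      fix i j :: nat
      assume "i < 4" "j < 4"
      then have "i \<in> {0, 1, 2, 3}" "j \<in> {0, 1, 2, 3}" by auto
      then show "([a, c, b, d] ! i, [a, c, b, d] ! j) \<in> parcs G \<longleftrightarrow> (i, j) \<in> parcs two_K2"
        by (elim insertE emptyE; simp add: n n' e[simplified] loop two_K2_def)
    qed (use V small in \<open>auto simp: two_K2_def\<close>)
    then show False using no_copy by blast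
  next
    fix a b c d e
    assume V: "{a, b, c, d, e} \<subseteq> pverts G"
      and n: "(a, b) \<notin> parcs G \<and> (b, c) \<notin> parcs G \<and> (c, d) \<notin> parcs G \<and> (d, e) \<notin> parcs G \<and>
        (e, a) \<notin> parcs G"
      and e: "\<not> ((a, c) \<notin> parcs G \<or> (a, d) \<notin> parcs G \<or> (b, d) \<notin> parcs G \<or>
        (b, e) \<notin> parcs G \<or> (c, e) \<notin> parcs G)"
    have n': "(b, a) \<notin> parcs G" "(c, b) \<notin> parcs G" "(d, c) \<notin> parcs G" "(e, d) \<notin> parcs G"
      "(a, e) \<notin> parcs G" "(c, a) \<in> parcs G" "(d, a) \<in> parcs G" "(d, b) \<in> parcs G"
      "(e, b) \<in> parcs G" "(e, c) \<in> parcs G"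
      using n e arc_commute by blast+
    \<comment> \<open>The complement of a 5-cycle is the 5-cycle of its diagonals, listed here in
      cyclic order.\<close>
    have "\<exists>H. induced_subgraph H (with_proj G) \<and> digraph_iso H (with_proj (cycle_graph 5))"
    proof (rule ex_induced_copy[OF G, where xs = "[a, c, e, b, d]" and n = 5])
      show "distinct [a, c, e, b, d]" using n e n' loop by auto
      fix i j :: nat
      assume "i < 5" "j < 5"
      then have "i \<in> {0, 1, 2, 3, 4}" "j \<in> {0, 1, 2, 3, 4}" by auto
      then show "([a, c, e, b, d] ! i, [a, c, e, b, d] ! j) \<in> parcs G \<longleftrightarrow>
          (i, j) \<in> parcs (cycle_graph 5)"
        by (elim insertE emptyE; simp add: n n' e[simplified] loop cycle_graph_def)
    qed (use V in \<open>auto simp: cycle_graph_def\<close>)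
    then show False using no_copy by blast
  next
    fix a b c d
    assume V: "{a, b, c, d} \<subseteq> pverts G"
      and e: "\<not> ((a, b) \<notin> parcs G \<or> (a, c) \<notin> parcs G \<or> (a, d) \<notin> parcs G \<or>
        (b, c) \<notin> parcs G \<or> (b, d) \<notin> parcs G \<or> (c, d) \<notin> parcs G)"
    have e': "(b, a) \<in> parcs G" "(c, a) \<in> parcs G" "(d, a) \<in> parcs G" "(c, b) \<in> parcs G"
      "(d, b) \<in> parcs G" "(d, c) \<in> parcs G"
      using e arc_commute by blast+
    have "\<exists>H. induced_subgraph H (with_proj G) \<and> digraph_iso H (with_proj (complete_graph 4))"
    proof (rule ex_induced_copy[OF G, where xs = "[a, b, c, d]" and n = 4])
      show "distinct [a, b, c, d]" using e e' loop by auto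
      fix i j :: nat
      assume "i < 4" "j < 4"
      then have "i \<in> {0, 1, 2, 3}" "j \<in> {0, 1, 2, 3}" by auto
      then show "([a, b, c, d] ! i, [a, b, c, d] ! j) \<in> parcs G \<longleftrightarrow>
          (i, j) \<in> parcs (complete_graph 4)"
        by (elim insertE emptyE; simp add: e[simplified] e' loop complete_graph_def)
    qed (use V in \<open>auto simp: complete_graph_def\<close>)
    then show False using no_copy by blast
  qed
qed

text \<open>Guarantees that the minimum in \<open>chromatic_number\<close> is attained. All vertices
  get different colours, shifted by one since colours start at 1.\<close>

lemma ex_coloring:
  assumes "pair_graph G"
  shows "\<exists>l. colorings G l \<noteq> {}"
proof -
  interpret pair_graph G by fact
  obtain f :: "'a \<Rightarrow> nat" and n where f: "f ` pverts G = {i. i < n}" "inj_on f (pverts G)"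
    using finite_imp_inj_to_nat_seg[OF finite_verts] by auto
  have "restrict (\<lambda>v. Suc (f v)) (pverts G) \<in> colorings G n"
  proof -
    have lt: "f v < n" if "v \<in> pverts G" for v
      using f(1) that by blast
    have "f u \<noteq> f v" "u \<in> pverts G" "v \<in> pverts G" if "(u, v) \<in> parcs G" for u v
      using inj_onD[OF f(2), of u v] in_arcsD1[OF that] in_arcsD2[OF that] no_loops'[OF that]
      by auto
    then show ?thesis
      using lt by (auto simp: colorings_def Suc_le_eq)
  qed
  then show ?thesis by blast
qed

theorem theorem1p5:
  fixes G :: "'a pair_pre_digraph"
  assumes "pair_graph G"
    and "induced_free [two_K2, complete_graph 4, cycle_graph 5] G"
  shows "recolorable G"
  unfolding recolorable_def
proof (intro allI impI)
  fix l
  assume l: "l > chromatic_number G"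
  interpret pair_graph G by fact
  interpret reflexive_symmetric "\<lambda>u v. (u, v) \<notin> parcs G"
    by (rule reflexive_symmetric_nonadjacent)
  let ?V = "pverts G" and ?R = "reconfiguration_graph G l"
  interpret R: pair_graph ?R
    by (rule pair_graph_reconfiguration_graph) simp
  \<comment> \<open>Elements of \<open>colorings\<close> are extensional while \<open>proper\<close>
    ignores values outside the vertex set; \<open>restrict\<close> mediates between the two.\<close>
  have proper_iff: "restrict f ?V \<in> colorings G k \<longleftrightarrow> proper ?V {1..k} f" for f :: "'a \<Rightarrow> nat" and k
  proof
    assume c: "restrict f ?V \<in> colorings G k"
    show "proper ?V {1..k} f"
    proof (rule properI)
      have "restrict f ?V \<in> ?V \<rightarrow>\<^sub>E {1..k}" using c by (simp add: colorings_def)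
      then show "f v \<in> {1..k}" if "v \<in> ?V" for v
        using PiE_mem[of "restrict f ?V" ?V "\<lambda>_. {1..k}" v] that by simp
      have "\<forall>(u, v)\<in>parcs G. restrict f ?V u \<noteq> restrict f ?V v"
        using c by (simp add: colorings_def)
      then show "(u, v) \<notin> parcs G" if "u \<in> ?V" "v \<in> ?V" "f u = f v" for u v
        using that by auto
    qed
  next
    assume p: "proper ?V {1..k} f"
    have "f u \<noteq> f v" "u \<in> ?V" "v \<in> ?V" if "(u, v) \<in> parcs G" for u v
      using proper_F[OF p, of u v] in_arcsD1[OF that] in_arcsD2[OF that] that by auto
    then show "restrict f ?V \<in> colorings G k"
      using proper_in[OF p] unfolding colorings_def by auto
  qed
  have vertsR: "pverts ?R = colorings G l"
    by (simp add: reconfiguration_graph_def)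
  have ext: "restrict f ?V = f" if "f \<in> colorings G k" for f k
    using that by (auto simp: colorings_def PiE_def extensional_restrict)
  obtain c where "c \<in> colorings G (chromatic_number G)"
    using LeastI_ex[OF ex_coloring[OF assms(1)]] unfolding chromatic_number_def by blast
  then have "proper ?V {1..chromatic_number G} c"
    using proper_iff ext by metis
  then have col: "colorable ?V (card {1..l} - 1)"
    by (rule colorableI) (use l in auto)
  have mix: "mixing ?V {1..l}"
    by (rule thin_mixing)
      (use l thin_induced_free[OF assms] col in auto)
  have reach: "restrict f ?V \<rightarrow>\<^sup>*\<^bsub>with_proj ?R\<^esub> restrict g ?V"
    if "recolors ?V {1..l} f g" "proper ?V {1..l} f" for f g
    using that
  proof (induction rule: rtranclp_induct)
    case base
    then have "restrict f ?V \<in> colorings G l" using proper_iff by blast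
    then show ?case
      using R.reachable_refl[of "restrict f ?V"] vertsR by blast
  next
    case (step g k)
    \<comment> \<open>A step that changes nothing on the vertex set gives equal restrictions instead
      of an arc.\<close>
    have "restrict g ?V = restrict k ?V \<or> (restrict g ?V, restrict k ?V) \<in> parcs ?R"
    proof -
      obtain x where x: "\<forall>u\<in>?V. u \<noteq> x \<longrightarrow> g u = k u"
        using step.hyps unfolding recolor_step_def by blast
      show ?thesis
      proof (cases "x \<in> ?V \<and> g x \<noteq> k x")
        case True
        then have "\<exists>!v. v \<in> ?V \<and> restrict g ?V v \<noteq> restrict k ?V v"
          using x by (intro ex1I[of _ x]) auto
        moreover have "restrict g ?V \<in> colorings G l" "restrict k ?V \<in> colorings G l"
          using step.hyps proper_iff unfolding recolor_step_def by blast+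
        ultimately show ?thesis by (simp add: reconfiguration_graph_def)
      next
        case False
        then have "restrict g ?V = restrict k ?V"
          using x by (intro restrict_ext) auto
        then show ?thesis ..
      qed
    qed
    then show ?case
    proof
      assume "restrict g ?V = restrict k ?V"
      then show ?case using step.IH[OF step.prems] by metis
    next
      assume "(restrict g ?V, restrict k ?V) \<in> parcs ?R"
      then show ?case
        by (intro R.reachable_adj_trans[OF step.IH[OF step.prems]]) (simp only: with_proj_simps)
    qed
  qed
  \<comment> \<open>Connectedness refers to the symmetric closure, so a path in the reconfiguration
    graph itself is transferred to it.\<close>
  show "Digraph_Component.connected (with_proj ?R)"
    unfolding connected_def strongly_connected_def
  proof (intro conjI ballI)
    show "verts (with_proj (mk_symmetric (with_proj ?R))) \<noteq> {}"
    proof -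
      obtain f where "proper ?V {1..l} f"
        using colorableD[OF col, of "{1..l}"] by auto
      then have "restrict f ?V \<in> colorings G l" using proper_iff by blast
      then show ?thesis using vertsR by auto
    qed
    fix f g
    assume "f \<in> verts (with_proj (mk_symmetric (with_proj ?R)))"
      and "g \<in> verts (with_proj (mk_symmetric (with_proj ?R)))"
    then have fg: "f \<in> colorings G l" "g \<in> colorings G l"
      by (simp_all add: reconfiguration_graph_def)
    then have pf: "proper ?V {1..l} f" and pg: "proper ?V {1..l} g"
      using proper_iff ext by metis+
    then have "restrict f ?V \<rightarrow>\<^sup>*\<^bsub>with_proj ?R\<^esub> restrict g ?V"
      using reach mix unfolding mixing_def by blast
    then show "f \<rightarrow>\<^sup>*\<^bsub>with_proj (mk_symmetric (with_proj ?R))\<^esub> g"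
      using R.reachable_mk_symmetricI ext fg by simp
  qed
qed

end
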